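(* Let $X_1,X_2,\ldots$ be i.i.d. real random variables with continuous distribution function $F$, $0<F(0)<1$, let $D(x)=\min(F(x),1-F(x))$ be the half-space depth, and let $R_n$ be the refined empirical half-space depth based on $X_1,\ldots,X_n$, defined in the context from $k$, the right-tail estimators $\hat\gamma,\hat a$ and the left-tail estimators $\hat\gamma_l,\hat a_l$. Let $k=k_n<n/2$ be positive integers with $k\to\infty$ and $k/n\to 0$ as $n\to\infty$, and let $\delta_n\in(0,1/2)$ be a sequence with $n\delta_n\to 0$ as $n\to\infty$. Assume that the following hold for the right tail of $F$ (with $V(t)=F^{-1}(1-1/t)$, $t>1$), and that their left-tail counterparts hold, i.e. the same conditions with $X_i$ replaced by $-X_i$ and with $(\gamma_l,\rho_l,A_l,\lambda_l,V_l,a_l,b_l,\hat\gamma_l,\hat a_l)$ in place of $(\gamma,\rho,A,\lambda,V,a,b,\hat\gamma,\hat a)$: (i) $V'$ exists and, with $b(t)=V(t)$ and $a(t)=tV'(t)>0$, for some $\gamma\in\mathbb{R}$, $$\lim_{t\to\infty}t\bigl(1-F(a(t)y+b(t))\bigr)=(1+\gamma y)^{-1/\gamma}\quad\text{for all } y \text{ with } 1+\gamma y>0;$$ (ii) for some $\rho<0$ and some eventually positive or eventually negative function $A$ with $\lim_{t\to\infty}A(t)=0$, $$\lim_{t\to\infty}\frac{V'(tx)/V'(t)-x^{\gamma-1}}{A(t)}=x^{\gamma-1}\,\frac{x^{\rho}-1}{\rho},\qquad x>0;$$ (iii) $\sqrt{k}\,A(n/k)\to\lambda$ as $n\to\infty$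 for some $\lambda\in\mathbb{R}$; (iv) $\sqrt{k}(\hat\gamma-\gamma)=O_p(1)$ and $\sqrt{k}\left(\frac{\hat a}{a(n/k)}-1\right)=O_p(1)$ as $n\to\infty$; (v) $w_\gamma\!\left(\frac{k}{n\delta_n}\right)\big/\sqrt{k}\to 0$ as $n\to\infty$, where $w_\gamma(t)=t^{-\gamma}\int_1^t s^{\gamma-1}\log s\,ds$, $t>1$. Then $$\sup_{x\in\mathbb{R}:\,D(x)\ge\delta_n}\left|\frac{R_n(x)}{D(x)}-1\right|\stackrel{p}{\to}0\qquad\text{as } n\to\infty.$$
   Context: Notation. $F^{-1}$ is the left-continuous inverse (quantile function) of $F$. $X_{1:n}\le\cdots\le X_{n:n}$ are the order statistics of $X_1,\ldots,X_n$. $F_n$ is the right-continuous empirical distribution function of $X_1,\ldots,X_n$, $S_n(x)=1-F_n(x^-)$, where $F_n(x^-)$ is the left limit, and the empirical half-space depth is $D_n(x)=\min(F_n(x),S_n(x))$. The symbol $\stackrel{p}{\to}$ is convergence in probability, and $O_p(1)$ means bounded in probability. The expression $(1+\gamma y)^{-1/\gamma}$ is read as $e^{-y}$ when $\gamma=0$ (likewise for estimated $\gamma$). Right-tail estimator. $\hat\gamma$ and $\hat a=\hat a(n/k)$ are estimators (functions of the sample) of $\gamma$ and of the positive scale $a=a(n/k)$, and $\hat b=X_{n-k:n}$. Put $$p_n^r(x)=\frac{k}{n}\left(\max\left[0,\,1+\hat\gamma\,\frac{x-\hat b}{\hat a}\right]\right)^{-1/\hat\gamma}.$$ Left-tail estimator.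 This is the same construction applied to $-X_1,\ldots,-X_n$. Let $V_l$ be the tail quantile function of $-X_1$ (i.e. $V_l(t)=F_-^{-1}(1-1/t)$ with $F_-$ the distribution function of $-X_1$), $b_l=V_l$, $a_l(t)=tV_l'(t)$, let $\hat\gamma_l$ and $\hat a_l$ be estimators of $\gamma_l$ and $a_l(n/k)$, and $\hat b_l=-X_{k+1:n}$. Put $$p_n^l(x)=\frac{k}{n}\left(\max\left[0,\,1+\hat\gamma_l\,\frac{-x-\hat b_l}{\hat a_l}\right]\right)^{-1/\hat\gamma_l}.$$ Refined empirical half-space depth. $R_n(x)=D_n(x)$ for $X_{k+1:n}<x<X_{n-k:n}$; $R_n(x)=p_n^r(x)$ for $x\ge X_{n-k:n}$; $R_n(x)=p_n^l(x)$ for $x\le X_{k+1:n}$. *)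

theory Defs
  imports "HOL-Probability.Probability"
begin

(* Samples are 0-based: for observations X_1, ..., X_n, the value of X_(i+1) is xs i, i < n. *)

definition sample :: "(nat \<Rightarrow> 'a \<Rightarrow> real) \<Rightarrow> nat \<Rightarrow> 'a \<Rightarrow> nat \<Rightarrow> real" where
  "sample X n \<omega> = (\<lambda>i\<in>{..<n}. X i \<omega>)"

(* X_(j:n) with the usual 1-based rank j; meaningful for 1 <= j <= n. *)
definition order_stat :: "nat \<Rightarrow> (nat \<Rightarrow> real) \<Rightarrow> nat \<Rightarrow> real" where
  "order_stat n xs j = sort (map xs [0..<n]) ! (j - 1)"

definition emp_cdf :: "nat \<Rightarrow> (nat \<Rightarrow> real) \<Rightarrow> real \<Rightarrow> real" where
  "emp_cdf n xs x = real (card {i\<in>{..<n}. xs i \<le> x}) / real n"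

definition emp_surv :: "nat \<Rightarrow> (nat \<Rightarrow> real) \<Rightarrow> real \<Rightarrow> real" where
  "emp_surv n xs x = 1 - Lim (at_left x) (emp_cdf n xs)"

definition emp_depth :: "nat \<Rightarrow> (nat \<Rightarrow> real) \<Rightarrow> real \<Rightarrow> real" where
  "emp_depth n xs x = min (emp_cdf n xs x) (emp_surv n xs x)"

definition depth :: "(real \<Rightarrow> real) \<Rightarrow> real \<Rightarrow> real" where
  "depth F x = min (F x) (1 - F x)"

definition quantile :: "(real \<Rightarrow> real) \<Rightarrow> real \<Rightarrow> real" where
  "quantile F u = Inf {x. u \<le> F x}"

definition tail_quantile :: "(real \<Rightarrow> real) \<Rightarrow> real \<Rightarrow> real" where
  "tail_quantile F t = quantile F (1 - 1 / t)"

definition tail_scale :: "(real \<Rightarrow> real) \<Rightarrow> real \<Rightarrow> real" where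
  "tail_scale F t = t * deriv (tail_quantile F) t"

(* (1 + g y)^(-1/g), with base cut off at 0 and value exp (- y) for g = 0.
   The cut-off has no effect where 1 + g y > 0. For g > 0 and 1 + g y <= 0 the convention
   0 powr c = 0 gives 0 instead of infinity; in the estimators below, with a positive scale
   estimate, this case does not occur, since they are used for y >= 0 only. *)
definition gp_tail :: "real \<Rightarrow> real \<Rightarrow> real" where
  "gp_tail g y = (if g = 0 then exp (- y) else max 0 (1 + g * y) powr (- 1 / g))"

(* p_n^r; the arguments g and c are the values of the estimators of the index and the scale. *)
definition right_tail_est :: "nat \<Rightarrow> nat \<Rightarrow> real \<Rightarrow> real \<Rightarrow> (nat \<Rightarrow> real) \<Rightarrow> real \<Rightarrow> real" where
  "right_tail_est n k g c xs x =
     real k / real n * gp_tail g ((x - order_stat n xs (n - k)) / c)"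

(* p_n^l; the location estimate is - X_(k+1:n). *)
definition left_tail_est :: "nat \<Rightarrow> nat \<Rightarrow> real \<Rightarrow> real \<Rightarrow> (nat \<Rightarrow> real) \<Rightarrow> real \<Rightarrow> real" where
  "left_tail_est n k g c xs x =
     real k / real n * gp_tail g ((- x - (- order_stat n xs (k + 1))) / c)"

definition refined_depth ::
  "nat \<Rightarrow> nat \<Rightarrow> real \<Rightarrow> real \<Rightarrow> real \<Rightarrow> real \<Rightarrow> (nat \<Rightarrow> real) \<Rightarrow> real \<Rightarrow> real" where
  "refined_depth n k g c gl cl xs x =
     (if order_stat n xs (k + 1) < x \<and> x < order_stat n xs (n - k) then emp_depth n xs x
      else if order_stat n xs (n - k) \<le> x then right_tail_est n k g c xs x
      else left_tail_est n k gl cl xs x)"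

definition extreme_value_cond :: "(real \<Rightarrow> real) \<Rightarrow> real \<Rightarrow> bool" where
  "extreme_value_cond F \<gamma> \<longleftrightarrow>
     (\<forall>t>1. tail_quantile F field_differentiable (at t)) \<and>
     (\<forall>t>1. tail_scale F t > 0) \<and>
     (\<forall>y. 1 + \<gamma> * y > 0 \<longrightarrow>
       ((\<lambda>t. t * (1 - F (tail_scale F t * y + tail_quantile F t))) \<longlongrightarrow> gp_tail \<gamma> y) at_top)"

definition second_order_cond ::
  "(real \<Rightarrow> real) \<Rightarrow> real \<Rightarrow> real \<Rightarrow> (real \<Rightarrow> real) \<Rightarrow> bool" where
  "second_order_cond F \<gamma> \<rho> A \<longleftrightarrow>
     \<rho> < 0 \<and>
     ((\<forall>\<^sub>F t in at_top. A t > 0) \<or> (\<forall>\<^sub>F t in at_top. A t < 0)) \<and>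
     (A \<longlongrightarrow> 0) at_top \<and>
     (\<forall>x>0. ((\<lambda>t. (deriv (tail_quantile F) (t * x) / deriv (tail_quantile F) t
                      - x powr (\<gamma> - 1)) / A t)
               \<longlongrightarrow> x powr (\<gamma> - 1) * ((x powr \<rho> - 1) / \<rho>)) at_top)"

definition w :: "real \<Rightarrow> real \<Rightarrow> real" where
  "w \<gamma> t = t powr (- \<gamma>) * integral {1..t} (\<lambda>s. s powr (\<gamma> - 1) * ln s)"

(* O_p(1), for measurable Y n. *)
definition bounded_in_prob :: "'a measure \<Rightarrow> (nat \<Rightarrow> 'a \<Rightarrow> real) \<Rightarrow> bool" where
  "bounded_in_prob M Y \<longleftrightarrow>
     (\<forall>\<epsilon>>0. \<exists>C. \<forall>\<^sub>F n in sequentially. measure M {\<omega>\<in>space M. \<bar>Y n \<omega>\<bar> > C} \<le> \<epsilon>)"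

(* Convergence in probability to a constant. The outer measure agrees with the measure on
   measurable events; it is used because Y n will be a supremum over an uncountable set, and
   measure M would silently assign 0 to a non-measurable event. *)
definition tendsto_in_prob :: "'a measure \<Rightarrow> (nat \<Rightarrow> 'a \<Rightarrow> ereal) \<Rightarrow> real \<Rightarrow> bool" where
  "tendsto_in_prob M Y c \<longleftrightarrow>
     (\<forall>\<epsilon>>0. (\<lambda>n. outer_measure_of M {\<omega>\<in>space M. \<bar>Y n \<omega> - ereal c\<bar> > ereal \<epsilon>}) \<longlonglongrightarrow> 0)"

end

theory Submission
  imports Defs
begin

text \<open>Only the right tail needs work, since the left tail is the right tail of the sample
  \<open>-X\<^sub>i\<close>. Put \<open>r = 1 / sqrt k\<close>, \<open>t = n / k\<close>, and write a point of the right tail as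
  \<open>x = V (t e\<^sup>T)\<close>, so that \<open>1 - F x = (k / n) e\<^bsup>-T\<^esup>\<close> and \<open>T \<le> ln (k / (n \<delta>\<^sub>n))\<close>.
  The second order condition with \<open>\<rho> < 0\<close> gives
  \<open>V' (t e\<^sup>T) / V' t = e\<^bsup>(\<gamma>-1)T\<^esup> (1 + O(r))\<close> uniformly in \<open>T \<ge> 0\<close>. Together with the rates of the
  estimators, the estimated standardised excess differs by \<open>O(r) (1 + L\<^sub>\<gamma> T)\<close> from
  \<open>L\<^sub>\<gamma> T = (e\<^bsup>\<gamma>T\<^esup> - 1) / \<gamma>\<close>, the inverse of the generalised Pareto tail on the scale \<open>e\<^sup>T\<close>.
  The resulting relative error of the tail estimate is of order \<open>r (1 + w\<^sub>\<gamma> (e\<^sup>T))\<close>, because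
  \<open>T\<close>, \<open>e\<^bsup>-\<gamma>T\<^esup>\<close> and \<open>e\<^bsup>-\<gamma>T\<^esup> L\<^sub>\<gamma> T\<close> are all \<open>O(1 + w\<^sub>\<gamma> (e\<^sup>T))\<close>. Between the two intermediate order
  statistics the claim reduces to uniform relative convergence of the empirical distribution
  function down to levels of order \<open>k / n\<close>, where \<open>k \<longrightarrow> \<infinity>\<close>.\<close>

section \<open>Generalised Pareto tails\<close>

text \<open>The weight in the rate condition is the sensitivity of the Pareto quantile to its index:
  the derivative of \<open>gp_quantile g T\<close> in \<open>g\<close> is the integral of s exp (g
  s) over [0, T], which is \<open>exp (g * T) * w_log g T\<close>, while a shift of T by h moves the
  quantile by \<open>exp (g * T) * gp_quantile g h\<close>. The exponential cancels, so an index
  error of order r acts like a shift of T by r times the weight, and a shift of T is a relative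
  error of the tail probability. The obstacle is that T is unbounded and that for a negative index
  the estimated tail is cut off at an end point. The tail function is therefore never expanded. Its
  argument is enclosed between the quantiles at T - h and T + h for the estimated index, where the
  tail function is known exactly. A second gap is that the random threshold may lie slightly below V
  t, where T is negative; monotonicity of the tail function bridges it. All randomness sits in four
  exceptional events per tail, off which the estimates are deterministic and uniform in x.\<close>

definition gp_quantile :: "real \<Rightarrow> real \<Rightarrow> real" where
  "gp_quantile g T = (if g = 0 then T else (exp (g * T) - 1) / g)"

text \<open>This is \<open>w\<close> at exp T in closed form, equivalently the integral of
  \<open>gp_quantile (- g)\<close> over [0, T]; g = 0 is the limiting case.\<close>

definition w_log :: "real \<Rightarrow> real \<Rightarrow> real" where
  "w_log g T = (if g = 0 then T\<^sup>2 / 2 else (T - gp_quantile (- g) T) / g)"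

lemma gp_quantile_0 [simp]: "gp_quantile g 0 = 0"
  by (simp add: gp_quantile_def)

lemma one_plus_gp_quantile: "1 + g * gp_quantile g T = exp (g * T)"
  by (simp add: gp_quantile_def)

lemma gp_tail_gp_quantile: "gp_tail g (gp_quantile g T) = exp (- T)"
  by (simp add: gp_tail_def gp_quantile_def powr_def)

lemma has_real_derivative_gp_quantile [derivative_intros]:
  assumes "(f has_real_derivative f') (at x within A)"
  shows "((\<lambda>x. gp_quantile g (f x)) has_real_derivative exp (g * f x) * f') (at x within A)"
  unfolding gp_quantile_def
  by (cases "g = 0") (use assms in \<open>auto intro!: derivative_eq_intros\<close>)

text \<open>For g > 0 the cut-off gives the value 0 where 1 + g * y <= 0, which would break
  monotonicity; positivity at the left point excludes this.\<close>

lemma gp_tail_antimono: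
  assumes "y1 \<le> y2" "1 + g * y1 > 0"
  shows "gp_tail g y2 \<le> gp_tail g y1"
proof (cases g "0::real" rule: linorder_cases)
  case less
  have "g * y2 \<le> g * y1" using less assms by (simp add: mult_left_mono_neg)
  then show ?thesis using less assms
    by (auto simp: gp_tail_def intro!: powr_mono2 divide_nonneg_neg)
next
  case equal
  then show ?thesis using assms by (simp add: gp_tail_def)
next
  case greater
  have "g * y1 \<le> g * y2" using greater assms by (simp add: mult_left_mono)
  then show ?thesis using greater assms
    by (auto simp: gp_tail_def max_def intro!: powr_mono2')
qed

text \<open>A shift of T acts on the quantile through the factor \<open>exp (g * T)\<close>. This
  converts an absolute error of the excess into a shift of T.\<close>

lemma gp_quantile_add:
  "gp_quantile g (T + h) = gp_quantile g T + exp (g * T) * gp_quantile g h"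
  by (cases "g = 0") (simp_all add: gp_quantile_def field_simps exp_add)

lemma gp_quantile_neg: "gp_quantile g (- h) = - gp_quantile (- g) h"
  by (auto simp: gp_quantile_def field_simps)

text \<open>Comparing derivatives replaces integral estimates throughout, so that the integrability
  of \<open>V'\<close> need not be discussed.\<close>

lemma diff_le_if_deriv_le:
  fixes f g :: "real \<Rightarrow> real"
  assumes "a \<le> b"
    and "\<And>x. a \<le> x \<Longrightarrow> x \<le> b \<Longrightarrow> (f has_real_derivative f' x) (at x)"
    and "\<And>x. a \<le> x \<Longrightarrow> x \<le> b \<Longrightarrow> (g has_real_derivative g' x) (at x)"
    and "\<And>x. a \<le> x \<Longrightarrow> x \<le> b \<Longrightarrow> f' x \<le> g' x"
  shows "f b - f a \<le> g b - g a"
proof -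
  have "(\<lambda>x. g x - f x) a \<le> (\<lambda>x. g x - f x) b"
  proof (rule DERIV_nonneg_imp_nondecreasing[OF assms(1)])
    fix x assume x: "a \<le> x" "x \<le> b"
    have "((\<lambda>x. g x - f x) has_real_derivative g' x - f' x) (at x)"
      using x assms by (auto intro!: derivative_intros)
    then show "\<exists>y. ((\<lambda>x. g x - f x) has_real_derivative y) (at x) \<and> 0 \<le> y"
      using assms(4)[OF x] by (intro exI[of _ "g' x - f' x"]) auto
  qed
  then show ?thesis by simp
qed

lemma abs_diff_le_if_deriv_le:
  fixes f g :: "real \<Rightarrow> real"
  assumes "a \<le> b"
    and f: "\<And>x. a \<le> x \<Longrightarrow> x \<le> b \<Longrightarrow> (f has_real_derivative f' x) (at x)"
    and g: "\<And>x. a \<le> x \<Longrightarrow> x \<le> b \<Longrightarrow> (g has_real_derivative g' x) (at x)"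
    and le: "\<And>x. a \<le> x \<Longrightarrow> x \<le> b \<Longrightarrow> \<bar>f' x\<bar> \<le> g' x"
  shows "\<bar>f b - f a\<bar> \<le> g b - g a"
proof -
  have "f b - f a \<le> g b - g a"
    by (rule diff_le_if_deriv_le[OF assms(1) f g]) (use le in fastforce)+
  moreover have "(\<lambda>x. - f x) b - (\<lambda>x. - f x) a \<le> g b - g a"
    by (rule diff_le_if_deriv_le[OF assms(1) _ g, where f' = "\<lambda>x. - f' x"])
       (use le f in \<open>auto intro!: derivative_intros simp: abs_le_iff\<close>)
  ultimately show ?thesis by simp
qed

text \<open>The derivative exp (g s) is at least exp (-\<bar>g\<bar> h) on [0, h]. The bound is the
  same for g and -g, so one constant serves both sides in \<open>gp_tail_sandwich\<close>.\<close>

lemma gp_quantile_ge: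
  assumes "0 \<le> h"
  shows "h * exp (- \<bar>g\<bar> * h) \<le> gp_quantile g h"
proof -
  have "h * exp (- \<bar>g\<bar> * h) - 0 * exp (- \<bar>g\<bar> * h) \<le> gp_quantile g h - gp_quantile g 0"
  proof (rule diff_le_if_deriv_le[OF assms])
    fix x assume x: "0 \<le> x" "x \<le> h"
    show "((\<lambda>x. x * exp (- \<bar>g\<bar> * h)) has_real_derivative exp (- \<bar>g\<bar> * h)) (at x)"
      by (auto intro!: derivative_eq_intros)
    show "(gp_quantile g has_real_derivative exp (g * x)) (at x)"
      by (auto intro!: derivative_eq_intros)
    have "- (\<bar>g\<bar> * h) \<le> - (\<bar>g\<bar> * x)" using x by (simp add: mult_left_mono)
    also have "\<dots> \<le> g * x" using x mult_right_mono[of "- \<bar>g\<bar>" g x] by auto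
    finally show "exp (- \<bar>g\<bar> * h) \<le> exp (g * x)" by simp
  qed
  then show ?thesis by simp
qed

lemma gp_quantile_nonneg: "0 \<le> h \<Longrightarrow> 0 \<le> gp_quantile g h"
  by (rule order_trans[OF _ gp_quantile_ge]) auto

section \<open>The weight function in logarithmic scale\<close>

lemma gp_quantile_w_log: "gp_quantile (- g) T = T - g * w_log g T"
  by (auto simp: w_log_def gp_quantile_def)

lemma exp_neg_w_log: "exp (- g * T) = 1 - g * gp_quantile (- g) T"
  using one_plus_gp_quantile[of "- g" T] by simp

lemma has_real_derivative_w_log:
  "(w_log g has_real_derivative gp_quantile (- g) T) (at T)"
proof (cases "g = 0")
  case True
  then have "w_log g = (\<lambda>T. T\<^sup>2 / 2)" by (auto simp: w_log_def)
  then show ?thesis using True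
    by (auto intro!: derivative_eq_intros simp: gp_quantile_def)
next
  case False
  then have "w_log g = (\<lambda>T. (T - gp_quantile (- g) T) / g)" by (auto simp: w_log_def)
  moreover have "((\<lambda>T. (T - gp_quantile (- g) T) / g) has_real_derivative
      (1 - exp (- g * T)) / g) (at T)"
    using False by (auto intro!: derivative_eq_intros)
  ultimately show ?thesis using exp_neg_w_log[of g T] False by simp
qed

lemma w_log_mono:
  assumes "0 \<le> S" "S \<le> T"
  shows "w_log g S \<le> w_log g T"
proof (rule DERIV_nonneg_imp_nondecreasing[OF assms(2)])
  fix x assume "S \<le> x" "x \<le> T"
  then show "\<exists>y. (w_log g has_real_derivative y) (at x) \<and> 0 \<le> y"
    using assms(1) has_real_derivative_w_log[of g x] gp_quantile_nonneg[of x "- g"] by auto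
qed

lemma w_log_0 [simp]: "w_log g 0 = 0"
  by (simp add: w_log_def)

lemma w_log_nonneg: "0 \<le> T \<Longrightarrow> 0 \<le> w_log g T"
  using w_log_mono[of 0 T g] w_log_0[of g] by linarith

text \<open>For g > 0, \<open>gp_quantile (- g)\<close> is bounded by 1 / g, so T and g *
  \<open>w_log g T\<close> differ by a bounded amount. For g <= 0 the derivative of
  \<open>w_log g\<close> is at least T, so growth is at least quadratic.\<close>

lemma le_w_log:
  assumes "0 \<le> T"
  shows "T \<le> (1 + \<bar>g\<bar> + (if g > 0 then 1 / g else 0)) * (1 + w_log g T)"
proof (cases "g > 0")
  case True
  have "gp_quantile (- g) T \<le> 1 / g"
    using True by (simp add: gp_quantile_def field_simps)
  then have "T \<le> g * w_log g T + 1 / g" using gp_quantile_w_log[of g T] by simp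
  also have "\<dots> \<le> (1 + \<bar>g\<bar> + 1 / g) * (1 + w_log g T)"
    using True w_log_nonneg[OF assms, of g] by (simp add: algebra_simps)
  finally show ?thesis using True by simp
next
  case False
  have "T\<^sup>2 / 2 - 0\<^sup>2 / 2 \<le> w_log g T - w_log g 0"
  proof (rule diff_le_if_deriv_le[OF assms])
    fix x assume x: "0 \<le> x" "x \<le> T"
    show "((\<lambda>x. x\<^sup>2 / 2) has_real_derivative x) (at x)"
      by (auto intro!: derivative_eq_intros)
    show "(w_log g has_real_derivative gp_quantile (- g) x) (at x)"
      by (rule has_real_derivative_w_log)
    have "g * w_log g x \<le> 0" using False x w_log_nonneg[of x g]
      by (simp add: mult_nonpos_nonneg)
    then show "x \<le> gp_quantile (- g) x" by (simp add: gp_quantile_w_log)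
  qed
  then have "T\<^sup>2 / 2 \<le> w_log g T" by simp
  moreover have "T \<le> 1 + T\<^sup>2 / 2"
    using zero_le_power2[of "T - 1"] by (simp add: power2_eq_square algebra_simps)
  ultimately have "T \<le> 1 * (1 + w_log g T)" by simp
  also have "\<dots> \<le> (1 + \<bar>g\<bar>) * (1 + w_log g T)"
    using w_log_nonneg[OF assms, of g] by (intro mult_right_mono) auto
  finally show ?thesis using False by simp
qed

lemma w_eq_w_log:
  assumes "1 \<le> t"
  shows "w g t = w_log g (ln t)"
proof (cases "g = 0")
  case True
  have "((\<lambda>s. s powr (g - 1) * ln s) has_integral (ln t)\<^sup>2 / 2 - (ln 1)\<^sup>2 / 2) {1..t}"
    using assms True
    by (intro fundamental_theorem_of_calculus)
       (auto intro!: derivative_eq_intros simp: powr_minus field_simps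
          simp flip: has_real_derivative_iff_has_vector_derivative)
  then show ?thesis using True assms by (simp add: w_def w_log_def integral_unique)
next
  case False
  \<comment> \<open>The antiderivative comes from integration by parts.\<close>
  let ?P = "\<lambda>s. s powr g * (ln s / g - 1 / g\<^sup>2)"
  have "((\<lambda>s. s powr (g - 1) * ln s) has_integral ?P t - ?P 1) {1..t}"
  proof (rule fundamental_theorem_of_calculus[OF assms])
    fix x assume x: "x \<in> {1..t}"
    have "(?P has_real_derivative
        g * x powr (g - 1) * (ln x / g - 1 / g\<^sup>2) + x powr g * (1 / x / g)) (at x within {1..t})"
      using x False by (auto intro!: derivative_eq_intros)
    also have "g * x powr (g - 1) * (ln x / g - 1 / g\<^sup>2) + x powr g * (1 / x / g)
        = x powr (g - 1) * ln x"
      using x False by (simp add: powr_diff power2_eq_square field_simps)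
    finally show "(?P has_vector_derivative x powr (g - 1) * ln x) (at x within {1..t})"
      by (simp add: has_real_derivative_iff_has_vector_derivative)
  qed
  then have "integral {1..t} (\<lambda>s. s powr (g - 1) * ln s) = ?P t + 1 / g\<^sup>2"
    by (simp add: integral_unique)
  then have "w g t = (t powr - g * t powr g) * (ln t / g - 1 / g\<^sup>2) + t powr - g / g\<^sup>2"
    unfolding w_def by (simp only:) (simp only: distrib_left mult.assoc[symmetric] times_divide_eq_right mult_1_right)
  moreover have "t powr - g * t powr g = 1" "t powr - g = exp (- g * ln t)"
    using assms by (auto simp: powr_def simp flip: exp_add)
  ultimately show ?thesis using False
    by (simp add: w_log_def gp_quantile_def power2_eq_square field_simps)
qed

section \<open>Errors in the index and in the excess\<close>

text \<open>The derivatives in T differ by exp (c x) (exp ((g - c) x) - 1), at most \<bar>g -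
  c\<bar> x exp (c x) up to the factor \<open>exp (\<bar>g - c\<bar> * T)\<close>. The primitive of
  x exp (c x) is \<open>exp (c * x) * w_log c x\<close>, which is how the weight enters.\<close>

lemma gp_quantile_perturb:
  assumes "0 \<le> T"
  shows "\<bar>gp_quantile g T - gp_quantile c T\<bar>
    \<le> \<bar>g - c\<bar> * exp (\<bar>g - c\<bar> * T) * (exp (c * T) * w_log c T)"
proof -
  let ?D = "\<bar>g - c\<bar> * exp (\<bar>g - c\<bar> * T)"
  have "\<bar>(gp_quantile g T - gp_quantile c T) - (gp_quantile g 0 - gp_quantile c 0)\<bar>
     \<le> ?D * (exp (c * T) * w_log c T) - ?D * (exp (c * 0) * w_log c 0)"
  proof (rule abs_diff_le_if_deriv_le[OF assms])
    fix x assume x: "0 \<le> x" "x \<le> T"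
    show "((\<lambda>T. gp_quantile g T - gp_quantile c T) has_real_derivative
        exp (g * x) - exp (c * x)) (at x)"
      by (auto intro!: derivative_eq_intros)
    have *: "c * exp (c * x) * w_log c x + exp (c * x) * gp_quantile (- c) x = exp (c * x) * x"
      by (simp add: gp_quantile_w_log algebra_simps)
    show "((\<lambda>z. ?D * (exp (c * z) * w_log c z)) has_real_derivative ?D * (exp (c * x) * x)) (at x)"
      unfolding *[symmetric]
      by (auto intro!: derivative_eq_intros has_real_derivative_w_log simp: algebra_simps)
    let ?z = "(g - c) * x"
    have "\<bar>exp ?z - 1\<bar> \<le> \<bar>?z\<bar> * exp \<bar>?z\<bar>"
    proof -
      have "1 - exp ?z \<le> \<bar>?z\<bar>" using exp_ge_add_one_self[of ?z] by linarith
      moreover have "\<bar>?z\<bar> * 1 \<le> \<bar>?z\<bar> * exp \<bar>?z\<bar>" by (intro mult_left_mono) auto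
      moreover have "exp ?z - 1 \<le> \<bar>?z\<bar> * exp \<bar>?z\<bar>"
      proof -
        have "1 - ?z \<le> exp (- ?z)" using exp_ge_add_one_self[of "- ?z"] by simp
        from mult_left_mono[OF this, of "exp ?z"]
        have "exp ?z * (1 - ?z) \<le> 1" by (simp flip: exp_add)
        then have "exp ?z - 1 \<le> ?z * exp ?z" by (simp add: algebra_simps)
        also have "\<dots> \<le> \<bar>?z\<bar> * exp \<bar>?z\<bar>" by (intro mult_mono) auto
        finally show ?thesis .
      qed
      ultimately show ?thesis by linarith
    qed
    also have "\<bar>?z\<bar> = \<bar>g - c\<bar> * x" using x by (simp add: abs_mult)
    also have "\<bar>g - c\<bar> * x * exp (\<bar>g - c\<bar> * x) \<le> \<bar>g - c\<bar> * x * exp (\<bar>g - c\<bar> * T)"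
      using x by (intro mult_left_mono) (auto intro: mult_left_mono)
    finally have "exp (c * x) * \<bar>exp ?z - 1\<bar> \<le> exp (c * x) * (\<bar>g - c\<bar> * x * exp (\<bar>g - c\<bar> * T))"
      by (intro mult_left_mono) auto
    moreover have "exp (c * x) * \<bar>exp ?z - 1\<bar> = \<bar>exp (g * x) - exp (c * x)\<bar>"
    proof -
      have "exp (g * x) - exp (c * x) = exp (c * x) * (exp ?z - 1)"
        by (simp add: algebra_simps flip: exp_add)
      then show ?thesis by (simp add: abs_mult)
    qed
    ultimately show "\<bar>exp (g * x) - exp (c * x)\<bar> \<le> ?D * (exp (c * x) * x)"
      by (simp only: mult_ac)
  qed
  then show ?thesis by simp
qed

text \<open>By the addition law and \<open>gp_quantile_ge\<close>, for g and for -g, the tolerance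
  keeps y between the quantiles at T - h and T + h. The monotone tail function takes the values exp
  (-(T - h)) and exp (-(T + h)) there.\<close>

lemma gp_tail_sandwich:
  assumes "0 \<le> h" "\<bar>y - gp_quantile g T\<bar> \<le> exp (g * T) * (h * exp (- \<bar>g\<bar> * h))"
  shows "exp (- h) \<le> exp T * gp_tail g y" "exp T * gp_tail g y \<le> exp h"
proof -
  have *: "exp (g * T) * (h * exp (- \<bar>g\<bar> * h)) \<le> exp (g * T) * gp_quantile g h"
    "exp (g * T) * (h * exp (- \<bar>g\<bar> * h)) \<le> exp (g * T) * gp_quantile (- g) h"
    using gp_quantile_ge[OF assms(1), of g] gp_quantile_ge[OF assms(1), of "- g"] by simp_all
  have up: "y \<le> gp_quantile g (T + h)"
    using * assms(2) unfolding gp_quantile_add by linarith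
  have lo: "gp_quantile g (T + - h) \<le> y"
    using * assms(2) unfolding gp_quantile_add gp_quantile_neg abs_le_iff by argo
  have 1: "gp_tail g y \<le> exp (- (T + - h))"
    using gp_tail_antimono[OF lo, of g] unfolding one_plus_gp_quantile gp_tail_gp_quantile by simp
  show "exp T * gp_tail g y \<le> exp h"
    using mult_left_mono[OF 1, of "exp T"] by (simp flip: exp_add)
  have "exp (- (T + h)) \<le> gp_tail g y"
  proof (cases "0 < 1 + g * y")
    case True
    then show ?thesis using gp_tail_antimono[OF up, of g] by (simp add: gp_tail_gp_quantile)
  next
    \<comment> \<open>The cut-off cannot act: whatever the sign of g, \<open>g * y\<close> is at
      least one of the two products at the end points, and both of these exceed -1.\<close>
    case False
    have "0 < 1 + g * gp_quantile g (T + - h)" "0 < 1 + g * gp_quantile g (T + h)"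
      unfolding one_plus_gp_quantile by simp_all
    moreover have "g * gp_quantile g (T + - h) \<le> g * y \<or> g * gp_quantile g (T + h) \<le> g * y"
      using up lo mult_left_mono mult_left_mono_neg by (metis linear)
    ultimately have "0 < 1 + g * y" by linarith
    then show ?thesis using False by simp
  qed
  from mult_left_mono[OF this, of "exp T"]
  show "exp (- h) \<le> exp T * gp_tail g y" by (simp flip: exp_add)
qed

text \<open>This deterministic core combines the error of the index with that of the excess. A
  single \<kappa> works for all T, although T may grow, because both r and r times the weight are
  bounded by \<kappa>.\<close>

lemma gp_tail_uniform:
  assumes "0 < \<eta>" "0 \<le> C"
  shows "\<exists>\<kappa>>0. \<forall>r T g y. 0 \<le> T \<longrightarrow> 0 \<le> r \<longrightarrow> r \<le> \<kappa> \<longrightarrow> r * w_log c T \<le> \<kappa> \<longrightarrow>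
    \<bar>g - c\<bar> \<le> C * r \<longrightarrow> \<bar>y - gp_quantile c T\<bar> \<le> C * r * (1 + gp_quantile c T) \<longrightarrow>
    \<bar>exp T * gp_tail g y - 1\<bar> \<le> \<eta>"
proof -
  \<comment> \<open>This shift makes exp h equal to 1 + \<eta>, and then exp (-h) >= 1 - \<eta>.
    \<open>K\<close> bounds T, and \<open>L\<close> bounds exp (-c T) + exp (-c T) L_c T, both
    relative to 1 + W; \<open>Q\<close> bounds exp (\<bar>g - c\<bar> T).\<close>
  define h where "h = ln (1 + \<eta>)"
  define K where "K = 1 + \<bar>c\<bar> + (if c > 0 then 1 / c else 0)"
  define L where "L = 1 + (1 + \<bar>c\<bar>) * (K + \<bar>c\<bar>)"
  define Q where "Q = exp (2 * C * K)"
  \<comment> \<open>Chosen so that the accumulated error meets the tolerance of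
    \<open>gp_tail_sandwich\<close>. One factor \<open>Q\<close> pays for replacing exp (c T) by exp
    (g T), and \<bar>c\<bar> + C bounds \<bar>g\<bar> because r <= 1. The summand 1 in 2 * C + 1
    keeps the denominator positive for C = 0.\<close>
  define \<kappa> where "\<kappa> = min 1 (h * exp (- (\<bar>c\<bar> + C) * h) / (Q * ((2 * C + 1) * (L + Q))))"
  have h: "0 < h" "exp h = 1 + \<eta>" "exp (- h) \<ge> 1 - \<eta>"
    using assms by (simp_all add: h_def exp_minus field_simps)
  have K: "1 \<le> K" by (simp add: K_def)
  then have L: "1 \<le> L" by (simp add: L_def)
  have Q: "0 < Q" by (simp add: Q_def)
  have P: "0 < Q * ((2 * C + 1) * (L + Q))" using L Q assms by simp
  have \<kappa>: "0 < \<kappa>" "\<kappa> \<le> 1" using h P by (auto simp: \<kappa>_def)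
  have "\<kappa> \<le> h * exp (- (\<bar>c\<bar> + C) * h) / (Q * ((2 * C + 1) * (L + Q)))"
    by (simp add: \<kappa>_def)
  then have \<kappa>': "\<kappa> * (2 * C + 1) * (L + Q) * Q \<le> h * exp (- (\<bar>c\<bar> + C) * h)"
    using P by (simp add: pos_le_divide_eq mult_ac)
  show ?thesis
  proof (intro exI[of _ \<kappa>] conjI allI impI \<kappa>(1))
    fix r T g y :: real
    assume T: "0 \<le> T" and r: "0 \<le> r" "r \<le> \<kappa>" and rW: "r * w_log c T \<le> \<kappa>"
      and g: "\<bar>g - c\<bar> \<le> C * r"
      and y: "\<bar>y - gp_quantile c T\<bar> \<le> C * r * (1 + gp_quantile c T)"
    define W J E where "W = w_log c T" and "J = gp_quantile (- c) T" and "E = exp (- c * T)"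
    have W: "0 \<le> W" using w_log_nonneg[OF T] by (simp add: W_def)
    have TW: "T \<le> K * (1 + W)" using le_w_log[OF T, of c] by (simp add: K_def W_def)
    have J0: "0 \<le> J" using gp_quantile_nonneg[OF T] by (simp add: J_def)
    have "J = T - c * W" by (simp add: J_def W_def gp_quantile_w_log)
    moreover have "- c * W \<le> \<bar>c\<bar> * (1 + W)" using W by (intro mult_mono) auto
    ultimately have J: "J \<le> (K + \<bar>c\<bar>) * (1 + W)" using TW by (simp add: distrib_right)
    have "E = 1 - c * J" unfolding E_def J_def by (rule exp_neg_w_log)
    also have "\<dots> \<le> 1 + \<bar>c\<bar> * J" using mult_right_mono[of "- c" "\<bar>c\<bar>" J] J0 by simp
    finally have "E + J \<le> 1 + (1 + \<bar>c\<bar>) * J" by (simp add: algebra_simps)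
    also have "\<dots> \<le> 1 * (1 + W) + (1 + \<bar>c\<bar>) * ((K + \<bar>c\<bar>) * (1 + W))"
      using J W by (intro add_mono mult_left_mono) auto
    finally have EJ: "E + J \<le> L * (1 + W)" by (simp add: L_def algebra_simps)
    have rW2: "r * (1 + W) \<le> 2 * \<kappa>" using r rW by (simp add: W_def algebra_simps)
    have "r * T \<le> r * (K * (1 + W))" using TW r by (intro mult_left_mono)
    also have "\<dots> = K * (r * (1 + W))" by simp
    also have "\<dots> \<le> K * 2" using rW2 \<kappa> K by (intro mult_left_mono) auto
    finally have rT: "C * (r * T) \<le> C * (K * 2)" using assms by (intro mult_left_mono)
    have gT: "\<bar>g - c\<bar> * T \<le> C * (r * T)"
      using mult_right_mono[OF g T] by simp
    have eQ: "exp (\<bar>g - c\<bar> * T) \<le> Q" using rT gT by (simp add: Q_def)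
    have exps: "exp (c * T) * E = 1" "exp (c * T) * J = gp_quantile c T"
      unfolding E_def J_def by (auto simp: gp_quantile_def field_simps simp flip: exp_add)
    have "\<bar>y - gp_quantile g T\<bar>
        \<le> \<bar>y - gp_quantile c T\<bar> + \<bar>gp_quantile g T - gp_quantile c T\<bar>" by simp
    also have "\<dots> \<le> C * r * (1 + gp_quantile c T) + (C * r) * Q * (exp (c * T) * W)"
    proof (rule add_mono[OF y order_trans[OF gp_quantile_perturb[OF T]]])
      show "\<bar>g - c\<bar> * exp (\<bar>g - c\<bar> * T) * (exp (c * T) * w_log c T)
          \<le> C * r * Q * (exp (c * T) * W)"
        unfolding W_def[symmetric] using g eQ W assms r by (intro mult_right_mono mult_mono) auto
    qed
    also have "\<dots> = exp (c * T) * ((C * r) * ((E + J) + Q * W))"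
    proof -
      have "1 + gp_quantile c T = exp (c * T) * (E + J)"
        using exps by (simp add: distrib_left)
      then show ?thesis by (simp only:) (simp add: algebra_simps)
    qed
    also have "\<dots> \<le> exp (c * T) * ((C * r) * ((L + Q) * (1 + W)))"
      using EJ Q assms r by (intro mult_left_mono) (auto simp: algebra_simps)
    also have "\<dots> = exp (c * T) * (C * (L + Q) * (r * (1 + W)))" by simp
    also have "\<dots> \<le> exp (c * T) * (C * (L + Q) * (2 * \<kappa>))"
      using rW2 L Q assms by (intro mult_left_mono) auto
    also have "\<dots> \<le> exp (c * T) * (\<kappa> * (2 * C + 1) * (L + Q))"
      using \<kappa> L Q by (intro mult_left_mono) (auto simp: algebra_simps)
    also have "\<dots> \<le> exp (c * T) * (exp ((g - c) * T) * (h * exp (- \<bar>g\<bar> * h)))"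
    proof (rule mult_left_mono)
      have "\<bar>g\<bar> \<le> \<bar>c\<bar> + C * 1"
        using g mult_left_mono[of r 1 C] r \<kappa> assms by linarith
      then have "h * exp (- (\<bar>c\<bar> + C) * h) \<le> h * exp (- \<bar>g\<bar> * h)"
        using h mult_right_mono[of "\<bar>g\<bar>" "\<bar>c\<bar> + C" h] by (simp add: left_diff_distrib distrib_right)
      with \<kappa>' have "\<kappa> * (2 * C + 1) * (L + Q) \<le> inverse Q * (h * exp (- \<bar>g\<bar> * h))"
        using Q by (simp add: field_simps)
      also have "\<dots> \<le> exp ((g - c) * T) * (h * exp (- \<bar>g\<bar> * h))"
      proof (rule mult_right_mono)
        have "- (C * (K * 2)) \<le> (g - c) * T"
          using rT gT mult_right_mono[of "- \<bar>g - c\<bar>" "g - c" T] T by linarith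
        then show "inverse Q \<le> exp ((g - c) * T)" by (simp add: Q_def flip: exp_minus)
      qed (use h in auto)
      finally show "\<kappa> * (2 * C + 1) * (L + Q) \<le> exp ((g - c) * T) * (h * exp (- \<bar>g\<bar> * h))" .
    qed simp
    also have "\<dots> = exp (g * T) * (h * exp (- \<bar>g\<bar> * h))"
      by (simp add: algebra_simps flip: exp_add)
    finally have "exp (- h) \<le> exp T * gp_tail g y" "exp T * gp_tail g y \<le> exp h"
      using gp_tail_sandwich[of h y g T] h by auto
    then show "\<bar>exp T * gp_tail g y - 1\<bar> \<le> \<eta>" using h by linarith
  qed
qed

section \<open>Second order regular variation\<close>

text \<open>For large N and all u >= N the set \<open>E N u\<close> fills more than 3/2 of [0, 2];
  otherwise dominated convergence along a sequence of bad u fails. For x in [0, 1], the part of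
  \<open>E N u\<close> in [0, 2] and the translate by x of the part of \<open>E N (u + x)\<close> in
  [0, 2] both lie in [0, 3]. Their measures add up to more than 3, so they meet.\<close>

lemma steinhaus_pair:
  fixes E :: "nat \<Rightarrow> real \<Rightarrow> real set"
  assumes meas: "\<And>N u. E N u \<in> sets borel"
    and ev: "\<And>v. v \<in> {0..2} \<Longrightarrow> \<exists>N0. \<forall>N\<ge>N0. \<forall>u\<ge>real N. v \<in> E N u"
  shows "\<exists>N. \<forall>u\<ge>real N. \<forall>x\<in>{0..1}. \<exists>v\<in>{0..2}. v \<in> E N (u + x) \<and> x + v \<in> E N u"
proof -
  have lm: "E N u \<inter> {0..2} \<in> lmeasurable" for N u
    by (rule bounded_set_imp_lmeasurable) (use meas in auto)
  have "\<exists>N. \<forall>u\<ge>real N. measure lebesgue (E N u \<inter> {0..2}) > 3/2"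
  proof (rule ccontr)
    assume "\<not> ?thesis"
    then obtain u where u: "u N \<ge> real N" "measure lebesgue (E N (u N) \<inter> {0..2}) \<le> 3/2" for N
      unfolding not_ex not_all not_less by (metis (mono_tags) not_less)
    have "(\<lambda>N. integral\<^sup>L lebesgue (indicat_real (E N (u N) \<inter> {0..2})))
        \<longlonglongrightarrow> integral\<^sup>L lebesgue (indicat_real {0..2::real})"
    proof (rule integral_dominated_convergence[where w = "indicat_real {0..2::real}"])
      show "AE v in lebesgue. (\<lambda>N. indicat_real (E N (u N) \<inter> {0..2}) v)
          \<longlonglongrightarrow> indicat_real {0..2::real} v"
      proof (rule AE_I2)
        fix v :: real
        have "\<forall>\<^sub>F N in sequentially. indicat_real (E N (u N) \<inter> {0..2}) v = indicat_real {0..2::real} v"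
        proof (cases "v \<in> {0..2}")
          case True
          then obtain N0 where "\<forall>N\<ge>N0. \<forall>u\<ge>real N. v \<in> E N u" using ev by blast
          then show ?thesis using u(1) unfolding eventually_sequentially
            by (intro exI[of _ N0]) (auto simp: indicator_def)
        qed auto
        then show "(\<lambda>N. indicat_real (E N (u N) \<inter> {0..2}) v) \<longlonglongrightarrow> indicat_real {0..2::real} v"
          by (rule tendsto_eventually)
      qed
      show "(\<lambda>x. indicat_real (E N (u N) \<inter> {0..2}) x) \<in> borel_measurable lebesgue" for N
        by (intro borel_measurable_indicator fmeasurableD lm)
      have "{0..2::real} \<in> lmeasurable" by simp
      then show "integrable lebesgue (indicat_real {0..2::real})"
        "indicat_real {0..2::real} \<in> borel_measurable lebesgue"
        by (auto simp: fmeasurable_def intro!: integrable_real_indicator borel_measurable_indicator)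
    qed (auto simp: indicator_def)
    then have "(\<lambda>N. measure lebesgue (E N (u N) \<inter> {0..2})) \<longlonglongrightarrow> 2"
      by simp
    from LIMSEQ_le_const2[OF this, of "3/2"] u(2) show False by auto
  qed
  then obtain N where N: "\<And>u. u \<ge> real N \<Longrightarrow> measure lebesgue (E N u \<inter> {0..2}) > 3/2"
    by blast
  show ?thesis
  proof (intro exI[of _ N] allI impI ballI)
    fix u x :: real assume u: "real N \<le> u" and x: "x \<in> {0..1}"
    let ?A = "E N u \<inter> {0..2}" and ?B = "(+) x ` (E N (u + x) \<inter> {0..2})"
    have B: "?B \<in> lmeasurable" using lm by (rule measurable_translation)
    have "measure lebesgue ?B > 3/2"
      using N[of "u + x"] u x by (simp add: measure_translation)
    moreover have "measure lebesgue ?A > 3/2" using N u by simp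
    moreover have "measure lebesgue (?A \<union> ?B) \<le> measure lebesgue {0..3::real}"
      using x lm B by (intro measure_mono_fmeasurable) (auto intro: fmeasurableD)
    ultimately have "?A \<inter> ?B \<noteq> {}"
      using measure_Union[of lebesgue ?A ?B] fmeasurableD2[OF lm] fmeasurableD2[OF B]
        fmeasurableD[OF lm] fmeasurableD[OF B] by auto
    then show "\<exists>v\<in>{0..2}. v \<in> E N (u + x) \<and> x + v \<in> E N u" by auto
  qed
qed

text \<open>In the next lemma \<open>\<phi> u = f (e\<^sup>u)\<close> for \<open>f t = t\<^bsup>1-\<gamma>\<^esup> V'(t)\<close>, and \<open>A\<close> is likewise taken in
  logarithmic scale. As \<open>A\<close> need not be measurable, it is replaced by the relative increment of
  \<open>\<phi>\<close> over a unit step, to which it is asymptotically proportional. Uniformity on unit intervals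
  is the Steinhaus argument of regular variation; \<open>\<rho> < 0\<close> makes the increments over
  consecutive unit steps summable.\<close>

lemma second_order_uniform:
  fixes \<phi> A :: "real \<Rightarrow> real"
  assumes meas: "\<phi> \<in> borel_measurable borel"
    and pos: "\<And>u. \<phi> u > 0"
    and A0: "(A \<longlongrightarrow> 0) at_top" "\<forall>\<^sub>F u in at_top. A u \<noteq> 0"
    and \<rho>: "\<rho> < 0"
    and lim: "\<And>v. ((\<lambda>u. (\<phi> (u + v) / \<phi> u - 1) / A u) \<longlongrightarrow> (exp (\<rho> * v) - 1) / \<rho>) at_top"
  shows "\<exists>C. \<forall>\<^sub>F u in at_top. \<forall>x\<ge>0. \<bar>\<phi> (u + x) / \<phi> u - 1\<bar> \<le> C * \<bar>A u\<bar>"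
proof -
  define q where "q u v = \<phi> (u + v) / \<phi> u - 1" for u v
  define B where "B u = q u 1" for u
  define \<psi> where "\<psi> v = (exp (\<rho> * v) - 1) / \<rho>" for v
  \<comment> \<open>The cocycle identity of relative increments. It drives the limit of B, the
    Steinhaus step and the induction over unit steps.\<close>
  have q_add: "q u (v + x) = q u v + q (u + v) x * (1 + q u v)" for u v x
    using pos[of u] pos[of "u + v"] by (simp add: q_def add.assoc field_simps)
  have limq: "((\<lambda>u. q u v / A u) \<longlongrightarrow> \<psi> v) at_top" for v
    using lim[of v] by (simp add: q_def \<psi>_def)
  have \<psi>1: "\<psi> 1 > 0" using \<rho> by (simp add: \<psi>_def divide_neg_neg)
  have q0: "((\<lambda>u. q u v) \<longlongrightarrow> 0) at_top" for v
  proof -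
    have "((\<lambda>u. q u v / A u * A u) \<longlongrightarrow> \<psi> v * 0) at_top"
      by (intro tendsto_mult limq A0)
    moreover have "\<forall>\<^sub>F u in at_top. q u v / A u * A u = q u v"
      using A0(2) by eventually_elim auto
    ultimately show ?thesis by (simp add: tendsto_cong)
  qed
  have B0: "\<forall>\<^sub>F u in at_top. B u \<noteq> 0"
  proof -
    have "\<forall>\<^sub>F u in at_top. q u 1 / A u > 0" using limq \<psi>1 by (rule order_tendstoD(1))
    then show ?thesis by eventually_elim (auto simp: B_def)
  qed
  have qB: "((\<lambda>u. q u v / B u) \<longlongrightarrow> \<psi> v / \<psi> 1) at_top" for v
  proof -
    have "((\<lambda>u. (q u v / A u) / (q u 1 / A u)) \<longlongrightarrow> \<psi> v / \<psi> 1) at_top"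
      using \<psi>1 by (intro tendsto_divide limq) auto
    moreover have "\<forall>\<^sub>F u in at_top. (q u v / A u) / (q u 1 / A u) = q u v / B u"
      using A0(2) by eventually_elim (auto simp: B_def)
    ultimately show ?thesis by (simp add: tendsto_cong)
  qed
  \<comment> \<open>By the cocycle identity, \<open>B (u + v) * (1 + q u v)\<close> is
    \<open>q u (v + 1) - q u v\<close>. Thus B varies regularly with index \<rho>, a property that
    it takes over from A.\<close>
  have BB: "((\<lambda>u. B (u + v) / B u) \<longlongrightarrow> exp (\<rho> * v)) at_top" for v
  proof -
    have "((\<lambda>u. (q u (v + 1) / B u - q u v / B u) / (1 + q u v)) \<longlongrightarrow>
        (\<psi> (v + 1) / \<psi> 1 - \<psi> v / \<psi> 1) / (1 + 0)) at_top"
      by (intro tendsto_intros qB q0) auto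
    also have "(\<psi> (v + 1) / \<psi> 1 - \<psi> v / \<psi> 1) / (1 + 0) = exp (\<rho> * v)"
    proof -
      have "\<psi> (v + 1) - \<psi> v = exp (\<rho> * v) * \<psi> 1"
        using \<rho> by (simp add: \<psi>_def field_simps exp_add)
      then show ?thesis using \<psi>1 by (simp add: diff_divide_distrib[symmetric])
    qed
    finally have *: "((\<lambda>u. (q u (v + 1) / B u - q u v / B u) / (1 + q u v)) \<longlongrightarrow> exp (\<rho> * v)) at_top" .
    have "(q u (v + 1) / B u - q u v / B u) / (1 + q u v) = B (u + v) / B u" for u
    proof -
      have "1 + q u v \<noteq> 0" using pos[of u] pos[of "u + v"] by (auto simp: q_def)
      moreover have "q u (v + 1) / B u - q u v / B u = B (u + v) * (1 + q u v) / B u"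
        by (simp add: q_add B_def diff_divide_distrib[symmetric])
      ultimately show ?thesis by simp
    qed
    then show ?thesis using * by simp
  qed
  have qmeas: "(\<lambda>v. q u v) \<in> borel_measurable borel" "(\<lambda>u. q u v) \<in> borel_measurable borel" for u v
    unfolding q_def using meas by measurable
  have Bmeas: "B \<in> borel_measurable borel"
    unfolding B_def[abs_def] by (rule qmeas)
  \<comment> \<open>With v in \<open>E N (u + x)\<close> and x + v in \<open>E N u\<close>, the
    increment over x is recovered from those over x + v and v. The comparisons of B in both
    directions lead from \<open>B (u + x)\<close> through \<open>B (u + x + v)\<close> back to
    \<open>B u\<close>.\<close>
  define E where "E N u = {v. \<bar>q u v\<bar> \<le> real N * \<bar>B u\<bar> \<and> \<bar>B (u + v)\<bar> \<le> real N * \<bar>B u\<bar>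
    \<and> \<bar>B u\<bar> \<le> real N * \<bar>B (u + v)\<bar>}" for N :: nat and u
  have "\<exists>N. \<forall>u\<ge>real N. \<forall>x\<in>{0..1}. \<exists>v\<in>{0..2}. v \<in> E N (u + x) \<and> x + v \<in> E N u"
  proof (rule steinhaus_pair)
    show "E N u \<in> sets borel" for N u
      unfolding E_def using qmeas Bmeas by measurable
    fix v :: real assume "v \<in> {0..2}"
    obtain n :: nat where n: "\<bar>\<psi> v / \<psi> 1\<bar> < real n" "exp (\<rho> * v) < real n" "exp (- (\<rho> * v)) < real n"
      using reals_Archimedean2[of "max \<bar>\<psi> v / \<psi> 1\<bar> (max (exp (\<rho> * v)) (exp (- (\<rho> * v))))"] by auto
    have n0: "real n > 0" using n(2) by (rule less_trans[OF exp_gt_zero])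
    have 1: "\<forall>\<^sub>F u in at_top. \<bar>q u v / B u\<bar> < real n"
      using tendsto_rabs[OF qB] n(1) by (rule order_tendstoD(2))
    have 2: "\<forall>\<^sub>F u in at_top. B (u + v) / B u < real n" "\<forall>\<^sub>F u in at_top. B (u + v) / B u > 0"
      "\<forall>\<^sub>F u in at_top. B (u + v) / B u > 1 / real n"
    proof -
      have "1 / real n < exp (\<rho> * v)" using n(3) n0 by (simp add: exp_minus field_simps)
      then show "\<forall>\<^sub>F u in at_top. B (u + v) / B u > 1 / real n"
        using BB by (intro order_tendstoD(1))
    qed (rule order_tendstoD[OF BB], use n(2) in simp)+
    have "\<forall>\<^sub>F u in at_top. v \<in> E n u"
      using 1 2 B0
    proof eventually_elim
      case (elim u)
      have Bu: "\<bar>B u\<bar> > 0" using elim by simp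
      have "\<bar>q u v\<bar> / \<bar>B u\<bar> < real n" "\<bar>B (u + v)\<bar> / \<bar>B u\<bar> < real n"
        "1 / real n < \<bar>B (u + v)\<bar> / \<bar>B u\<bar>"
        using elim by (simp_all only: abs_divide[symmetric] abs_of_pos)
      then show ?case using n0 Bu by (simp add: E_def field_simps)
    qed
    then obtain u0 where u0: "\<And>u. u \<ge> u0 \<Longrightarrow> v \<in> E n u"
      unfolding eventually_at_top_linorder by blast
    obtain m :: nat where m: "u0 \<le> real m" using real_arch_simple by blast
    show "\<exists>N0. \<forall>N\<ge>N0. \<forall>u\<ge>real N. v \<in> E N u"
    proof (intro exI[of _ "max n m"] allI impI)
      fix N u assume N: "max n m \<le> N" "real N \<le> u"
      then have "u0 \<le> u" "real n \<le> real N" using m by auto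
      then have "v \<in> E n u" "\<And>b. real n * \<bar>b\<bar> \<le> real N * \<bar>b\<bar>"
        using u0 by (auto intro: mult_right_mono)
      then show "v \<in> E N u" unfolding E_def by (blast intro: order_trans)
    qed
  qed
  then obtain N :: nat where N: "\<And>u x. real N \<le> u \<Longrightarrow> x \<in> {0..1} \<Longrightarrow>
      \<exists>v\<in>{0..2}. v \<in> E N (u + x) \<and> x + v \<in> E N u"
    by blast
  have Bto0: "((\<lambda>u. \<bar>B u\<bar>) \<longlongrightarrow> 0) at_top"
    using tendsto_rabs[OF q0[of 1]] by (simp add: B_def)
  \<comment> \<open>One factor N for each link of the chain from \<open>q (u + x) v\<close> to
    \<open>B (u + x)\<close>, to \<open>B (u + x + v)\<close>, to \<open>B u\<close>.\<close>
  define N3 where "N3 = real N ^ 3"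
  have "((\<lambda>u. N3 * \<bar>B u\<bar>) \<longlongrightarrow> N3 * 0) at_top" by (intro tendsto_intros Bto0)
  then have small: "\<forall>\<^sub>F u in at_top. N3 * \<bar>B u\<bar> < 1 / 2"
    by (rule order_tendstoD(2)) simp
  define C1 where "C1 = 2 * (real N + N3) + 1"
  have unit: "\<forall>\<^sub>F u in at_top. \<forall>x\<in>{0..1}. \<bar>q u x\<bar> \<le> C1 * \<bar>B u\<bar>"
    using small eventually_ge_at_top[of "real N"]
  proof eventually_elim
    case (elim u)
    show ?case
    proof
      fix x :: real assume x: "x \<in> {0..1}"
      obtain v where v: "v \<in> E N (u + x)" "x + v \<in> E N u" using N[OF elim(2) x] by blast
      have a: "\<bar>q u (x + v)\<bar> \<le> real N * \<bar>B u\<bar>" using v by (simp add: E_def)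
      have "\<bar>q (u + x) v\<bar> \<le> real N * \<bar>B (u + x)\<bar>" using v by (simp add: E_def)
      also have "\<dots> \<le> real N * (real N * \<bar>B (u + x + v)\<bar>)"
        using v by (intro mult_left_mono) (auto simp: E_def)
      also have "\<dots> \<le> real N * (real N * (real N * \<bar>B u\<bar>))"
        using v by (intro mult_left_mono) (auto simp: E_def add.assoc)
      finally have b: "\<bar>q (u + x) v\<bar> \<le> N3 * \<bar>B u\<bar>"
        by (simp add: N3_def power3_eq_cube mult.assoc)
      have c: "1 / 2 \<le> 1 + q (u + x) v" using b elim(1) by linarith
      have "q u x * (1 + q (u + x) v) = q u (x + v) - q (u + x) v"
        unfolding q_add[of u x v] by (simp add: algebra_simps)
      then have "\<bar>q u x\<bar> * \<bar>1 + q (u + x) v\<bar> \<le> (real N + N3) * \<bar>B u\<bar>"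
        using a b by (simp add: abs_mult[symmetric] distrib_right)
      moreover have "\<bar>q u x\<bar> * (1 / 2) \<le> \<bar>q u x\<bar> * \<bar>1 + q (u + x) v\<bar>"
        using c by (intro mult_left_mono) auto
      ultimately have "\<bar>q u x\<bar> \<le> 2 * ((real N + N3) * \<bar>B u\<bar>)" by linarith
      then show "\<bar>q u x\<bar> \<le> C1 * \<bar>B u\<bar>" by (simp add: C1_def algebra_simps)
    qed
  qed
  \<comment> \<open>\<theta> bounds the decay of B over a unit step, possible since exp \<rho> < 1.
    The gap between \<theta> and \<open>\<theta>'\<close> absorbs the factor
    \<open>1 + q u 1\<close>.\<close>
  define \<theta> where "\<theta> = (1 + exp \<rho>) / 2"
  define \<theta>' where "\<theta>' = (1 + \<theta>) / 2"
  have \<theta>: "0 < \<theta>" "\<theta> < 1" "exp \<rho> < \<theta>" "\<theta> < \<theta>'" "\<theta>' < 1"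
    using \<rho> by (auto simp: \<theta>_def \<theta>'_def intro: add_pos_pos)
  have C1: "C1 > 0" by (simp add: C1_def N3_def add_nonneg_pos)
  have dec: "\<forall>\<^sub>F u in at_top. \<bar>B (u + 1)\<bar> \<le> \<theta> * \<bar>B u\<bar>"
  proof -
    have "\<forall>\<^sub>F u in at_top. \<bar>B (u + 1) / B u\<bar> < \<theta>"
      using tendsto_rabs[OF BB[of 1]] by (rule order_tendstoD(2)) (use \<theta> in simp)
    then show ?thesis using B0
      by eventually_elim (simp add: abs_divide pos_divide_less_eq)
  qed
  have "((\<lambda>u. C1 * \<bar>B u\<bar>) \<longlongrightarrow> C1 * 0) at_top" by (intro tendsto_intros Bto0)
  then have small': "\<forall>\<^sub>F u in at_top. C1 * \<bar>B u\<bar> < \<theta>' / \<theta> - 1"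
    using \<theta> by (intro order_tendstoD(2)) auto
  obtain u1 where u1: "\<And>u x. u \<ge> u1 \<Longrightarrow> x \<in> {0..1} \<Longrightarrow> \<bar>q u x\<bar> \<le> C1 * \<bar>B u\<bar>"
      "\<And>u. u \<ge> u1 \<Longrightarrow> \<bar>B (u + 1)\<bar> \<le> \<theta> * \<bar>B u\<bar>" "\<And>u. u \<ge> u1 \<Longrightarrow> C1 * \<bar>B u\<bar> < \<theta>' / \<theta> - 1"
    using eventually_conj[OF unit eventually_conj[OF dec small']]
    unfolding eventually_at_top_linorder by blast
  \<comment> \<open>The fixed point of D = C1 + \<open>\<theta>'\<close> D, so that the induction on
    the length of the interval reproduces its own constant.\<close>
  define D where "D = C1 / (1 - \<theta>')"
  have D: "D > 0" "C1 \<le> D" "C1 + \<theta>' * D = D" using C1 \<theta> by (auto simp: D_def field_simps)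
  have "\<forall>u\<ge>u1. \<forall>x\<in>{0..real m + 1}. \<bar>q u x\<bar> \<le> D * \<bar>B u\<bar>" for m
  proof (induction m)
    case 0
    have "C1 * \<bar>B u\<bar> \<le> D * \<bar>B u\<bar>" for u using D(2) by (rule mult_right_mono) simp
    then show ?case using order_trans[OF u1(1)] by simp
  next
    case (Suc m)
    show ?case
    proof (intro allI impI ballI)
      fix u x assume u: "u1 \<le> u" and x: "x \<in> {0..real (Suc m) + 1}"
      show "\<bar>q u x\<bar> \<le> D * \<bar>B u\<bar>"
      proof (cases "x \<le> real m + 1")
        case True
        then show ?thesis using Suc u x by auto
      next
        case False
        then have y: "x - 1 \<in> {0..real m + 1}" using x by auto
        have "\<bar>q (u + 1) (x - 1)\<bar> \<le> D * \<bar>B (u + 1)\<bar>" using Suc u y by auto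
        also have "\<dots> \<le> D * (\<theta> * \<bar>B u\<bar>)" using D u u1(2) by (intro mult_left_mono) auto
        finally have a: "\<bar>q (u + 1) (x - 1)\<bar> \<le> D * (\<theta> * \<bar>B u\<bar>)" .
        have b: "\<bar>q u 1\<bar> \<le> C1 * \<bar>B u\<bar>" using u1(1)[OF u, of 1] by simp
        with u1(3)[OF u] have c: "\<bar>1 + q u 1\<bar> \<le> \<theta>' / \<theta>" by linarith
        have "q u x = q u 1 + q (u + 1) (x - 1) * (1 + q u 1)" using q_add[of u 1 "x - 1"] by simp
        then have "\<bar>q u x\<bar> \<le> \<bar>q u 1\<bar> + \<bar>q (u + 1) (x - 1)\<bar> * \<bar>1 + q u 1\<bar>"
          by (simp add: abs_mult[symmetric])
        also have "\<dots> \<le> C1 * \<bar>B u\<bar> + D * (\<theta> * \<bar>B u\<bar>) * (\<theta>' / \<theta>)"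
          using D \<theta> by (intro add_mono b mult_mono a c) auto
        also have "\<dots> = (C1 + \<theta>' * D) * \<bar>B u\<bar>" using \<theta> by (simp add: field_simps)
        finally show ?thesis by (simp add: D(3))
      qed
    qed
  qed
  then have all: "\<bar>q u x\<bar> \<le> D * \<bar>B u\<bar>" if "u \<ge> u1" "x \<ge> 0" for u x
    using that real_arch_simple[of x] by (metis add_increasing2 atLeastAtMost_iff zero_le_one)
  have BA: "\<forall>\<^sub>F u in at_top. \<bar>B u\<bar> \<le> 2 * \<psi> 1 * \<bar>A u\<bar>"
  proof -
    have "\<forall>\<^sub>F u in at_top. \<bar>q u 1 / A u\<bar> < 2 * \<psi> 1"
      using tendsto_rabs[OF limq] by (rule order_tendstoD(2)) (use \<psi>1 in simp)
    then show ?thesis using A0(2)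
      by eventually_elim (simp add: abs_divide pos_divide_less_eq B_def)
  qed
  show ?thesis
  proof (intro exI[of _ "D * (2 * \<psi> 1)"])
    show "\<forall>\<^sub>F u in at_top. \<forall>x\<ge>0. \<bar>\<phi> (u + x) / \<phi> u - 1\<bar> \<le> D * (2 * \<psi> 1) * \<bar>A u\<bar>"
      using BA eventually_ge_at_top[of u1]
    proof eventually_elim
      case (elim u)
      have "D * \<bar>B u\<bar> \<le> D * (2 * \<psi> 1 * \<bar>A u\<bar>)" using elim D by (intro mult_left_mono) auto
      then show ?case using all[OF elim(2)] by (fastforce simp: q_def)
    qed
  qed
qed

section \<open>Tail quantile functions\<close>

locale continuous_cdf =
  fixes F :: "real \<Rightarrow> real"
  assumes mono: "x \<le> y \<Longrightarrow> F x \<le> F y"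
    and cont: "continuous_on UNIV F"
    and bot: "(F \<longlongrightarrow> 0) at_bot"
    and top: "(F \<longlongrightarrow> 1) at_top"
begin

text \<open>Continuity closes the superlevel set, so its infimum is attained; the intermediate value
  theorem then excludes a value above u there.\<close>

lemma quantile_continuous_cdf:
  assumes u: "0 < u" "u < 1"
  shows "quantile F u \<le> x \<longleftrightarrow> u \<le> F x" "F (quantile F u) = u"
proof -
  let ?S = "{x. u \<le> F x}"
  obtain z where z: "F z > u"
    using eventually_happens'[OF _ order_tendstoD(1)[OF top u(2)]] by auto
  obtain y where y: "F y < u"
    using eventually_happens'[OF _ order_tendstoD(2)[OF bot u(1)]] by auto
  have bdd: "bdd_below ?S"
  proof (rule bdd_belowI[of _ y])
    fix x assume "x \<in> ?S"
    then show "y \<le> x" using y mono[of x y] by (cases "y \<le> x") auto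
  qed
  have "closed ?S"
    using cont by (intro closed_Collect_le) (auto intro: continuous_intros)
  then have in_S: "quantile F u \<in> ?S"
    unfolding quantile_def using bdd z by (intro closed_contains_Inf) (auto intro: less_imp_le)
  have le: "quantile F u \<le> x" if "u \<le> F x" for x
    unfolding quantile_def using bdd that by (intro cInf_lower) auto
  then show "quantile F u \<le> x \<longleftrightarrow> u \<le> F x"
    using in_S mono[of "quantile F u" x] by auto
  have "y \<le> quantile F u" using in_S y mono[of "quantile F u" y] by (cases "y \<le> quantile F u") auto
  then obtain x where "x \<le> quantile F u" "F x = u"
    using IVT'[of F y u "quantile F u"] in_S y continuous_on_subset[OF cont] by auto
  with le[of x] show "F (quantile F u) = u" by auto
qed

lemma F_tail_quantile: "1 < s \<Longrightarrow> F (tail_quantile F s) = 1 - 1 / s"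
  unfolding tail_quantile_def by (rule quantile_continuous_cdf(2)) auto

lemma tail_quantile_le_iff: "1 < s \<Longrightarrow> tail_quantile F s \<le> x \<longleftrightarrow> 1 - 1 / s \<le> F x"
  unfolding tail_quantile_def by (rule quantile_continuous_cdf(1)) auto

text \<open>If V s < x, continuity of V at s gives V s' < x for some s' > s, hence F x >= 1 - 1 / s'
  > 1 - 1 / s. So F has no flat piece at this level.\<close>

lemma tail_quantile_F:
  assumes "isCont (tail_quantile F) s" "1 < s" "F x = 1 - 1 / s"
  shows "tail_quantile F s = x"
proof (rule ccontr)
  assume ne: "tail_quantile F s \<noteq> x"
  have "tail_quantile F s \<le> x" using tail_quantile_le_iff assms by simp
  with ne have "\<forall>\<^sub>F s' in at s. tail_quantile F s' < x"
    using assms(1) by (intro order_tendstoD(2)[of _ "tail_quantile F s"]) (auto simp: isCont_def)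
  then have "\<forall>\<^sub>F s' in at_right s. tail_quantile F s' < x"
    by (auto simp: eventually_at_split)
  then obtain s' where s': "s < s'" "tail_quantile F s' < x"
    using eventually_happens'[OF _ eventually_conj[OF _ eventually_at_right_less[of s]]]
    by (metis trivial_limit_at_right_real)
  have "1 - 1 / s' \<le> F x" using s' assms tail_quantile_le_iff[of s' x] by auto
  moreover have "1 / s' < 1 / s" using s' assms by (simp add: frac_less2)
  ultimately show False using assms by simp
qed

end

section \<open>The derivative of the tail quantile function\<close>

lemma deriv_tail_quantile_pos:
  assumes "extreme_value_cond F \<gamma>" "1 < t"
  shows "deriv (tail_quantile F) t > 0" "tail_scale F t > 0"
    "(tail_quantile F has_real_derivative deriv (tail_quantile F) t) (at t)"
proof -
  show *: "tail_scale F t > 0" using assms by (simp add: extreme_value_cond_def)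
  then show "deriv (tail_quantile F) t > 0"
    using assms(2) by (simp add: tail_scale_def zero_less_mult_iff)
  show "(tail_quantile F has_real_derivative deriv (tail_quantile F) t) (at t)"
    using assms by (simp add: extreme_value_cond_def field_differentiable_derivI)
qed

lemma has_real_derivative_tail_quantile_exp:
  assumes "extreme_value_cond F \<gamma>" "1 < t * exp x"
  shows "((\<lambda>x. tail_quantile F (t * exp x)) has_real_derivative
    deriv (tail_quantile F) (t * exp x) * (t * exp x)) (at x)"
proof -
  have "((\<lambda>x. t * exp x) has_real_derivative t * exp x) (at x)"
    by (auto intro!: derivative_eq_intros)
  from DERIV_chain2[OF deriv_tail_quantile_pos(3)[OF assms] this] show ?thesis .
qed

text \<open>The derivative is a pointwise limit of difference quotients of a continuous function.
  The default value 1 for u <= 0 keeps the function positive everywhere, as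
  \<open>second_order_uniform\<close> requires.\<close>

lemma borel_measurable_deriv_tail_quantile_exp:
  assumes "extreme_value_cond F \<gamma>"
  shows "(\<lambda>u. if u \<in> {0<..} then deriv (tail_quantile F) (exp u) else 1) \<in> borel_measurable borel"
proof (rule borel_measurable_LIMSEQ_real)
  let ?V = "tail_quantile F"
  let ?g = "\<lambda>n u. (?V (exp u + inverse (real (Suc n))) - ?V (exp u)) / inverse (real (Suc n))"
  have cont: "isCont ?V t" if "1 < t" for t
    using deriv_tail_quantile_pos(3)[OF assms that] by (rule DERIV_isCont)
  show "(\<lambda>u. if u \<in> {0<..} then ?g n u else 1) \<in> borel_measurable borel" for n
  proof (rule borel_measurable_continuous_on_if)
    have V: "continuous_on {1<..} ?V"
      using cont by (auto intro: continuous_at_imp_continuous_on)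
    have gt: "1 < exp u + inverse (real (Suc n))" if "0 < u" for u :: real
    proof -
      have "0 < inverse (real (Suc n))" "1 < exp u" using that by auto
      then show ?thesis by linarith
    qed
    show "continuous_on {0<..} (?g n)"
      by (intro continuous_intros continuous_on_compose2[OF V]) (use gt in auto)
  qed auto
  fix u :: real
  show "(\<lambda>n. if u \<in> {0<..} then ?g n u else 1)
      \<longlonglongrightarrow> (if u \<in> {0<..} then deriv ?V (exp u) else 1)"
  proof (cases "0 < u")
    case True
    then have "((\<lambda>h. (?V (exp u + h) - ?V (exp u)) / h) \<longlongrightarrow> deriv ?V (exp u)) (at 0)"
      using deriv_tail_quantile_pos(3)[OF assms, of "exp u"] by (simp add: DERIV_def)
    moreover have "filterlim (\<lambda>n. inverse (real (Suc n))) (at 0) sequentially"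
      using LIMSEQ_inverse_real_of_nat by (simp add: filterlim_at)
    ultimately show ?thesis using True
      by (simp add: filterlim_compose[where g = "\<lambda>h. (?V (exp u + h) - ?V (exp u)) / h"])
  qed simp
qed

lemma deriv_tail_quantile_uniform:
  assumes ev: "extreme_value_cond F \<gamma>" and so: "second_order_cond F \<gamma> \<rho> A"
  shows "\<exists>C. \<forall>\<^sub>F t in at_top. \<forall>T\<ge>0.
    \<bar>exp ((1 - \<gamma>) * T) * deriv (tail_quantile F) (t * exp T) / deriv (tail_quantile F) t - 1\<bar>
      \<le> C * \<bar>A t\<bar>"
proof -
  let ?D = "deriv (tail_quantile F)"
  define \<phi> where "\<phi> u = exp ((1 - \<gamma>) * u) * (if u \<in> {0<..} then ?D (exp u) else 1)" for u
  have A: "(A \<longlongrightarrow> 0) at_top" "\<forall>\<^sub>F t in at_top. A t \<noteq> 0" "\<rho> < 0"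
    using so by (auto simp: second_order_cond_def elim: eventually_mono)
  have "\<exists>C. \<forall>\<^sub>F u in at_top. \<forall>x\<ge>0. \<bar>\<phi> (u + x) / \<phi> u - 1\<bar> \<le> C * \<bar>A (exp u)\<bar>"
  proof (rule second_order_uniform)
    show "\<phi> \<in> borel_measurable borel"
      unfolding \<phi>_def using borel_measurable_deriv_tail_quantile_exp[OF ev] by measurable
    show "\<phi> u > 0" for u
      using deriv_tail_quantile_pos(1)[OF ev, of "exp u"] by (simp add: \<phi>_def)
    show "((\<lambda>u. A (exp u)) \<longlongrightarrow> 0) at_top"
      using A(1) exp_at_top by (rule filterlim_compose)
    show "\<forall>\<^sub>F u in at_top. A (exp u) \<noteq> 0"
      using A(2) exp_at_top by (rule eventually_compose_filterlim)
    show "\<rho> < 0" by (rule A)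
    fix v :: real
    let ?x = "exp v"
    have "((\<lambda>t. (?D (t * ?x) / ?D t - ?x powr (\<gamma> - 1)) / A t)
        \<longlongrightarrow> ?x powr (\<gamma> - 1) * ((?x powr \<rho> - 1) / \<rho>)) at_top"
      using so by (simp add: second_order_cond_def)
    from filterlim_compose[OF this exp_at_top]
    have "((\<lambda>u. exp ((1 - \<gamma>) * v) * ((?D (exp u * ?x) / ?D (exp u) - ?x powr (\<gamma> - 1)) / A (exp u)))
        \<longlongrightarrow> exp ((1 - \<gamma>) * v) * (?x powr (\<gamma> - 1) * ((?x powr \<rho> - 1) / \<rho>))) at_top"
      by (intro tendsto_mult tendsto_const)
    also have "exp ((1 - \<gamma>) * v) * (?x powr (\<gamma> - 1) * ((?x powr \<rho> - 1) / \<rho>)) = (exp (\<rho> * v) - 1) / \<rho>"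
      by (simp add: powr_def mult.assoc[symmetric] algebra_simps flip: exp_add)
    finally have lim: "((\<lambda>u. exp ((1 - \<gamma>) * v) * ((?D (exp u * ?x) / ?D (exp u) - ?x powr (\<gamma> - 1)) / A (exp u)))
        \<longlongrightarrow> (exp (\<rho> * v) - 1) / \<rho>) at_top" .
    have "\<forall>\<^sub>F u in at_top. exp ((1 - \<gamma>) * v) * ((?D (exp u * ?x) / ?D (exp u) - ?x powr (\<gamma> - 1)) / A (exp u))
        = (\<phi> (u + v) / \<phi> u - 1) / A (exp u)"
      using eventually_gt_at_top[of 0] eventually_gt_at_top[of "- v"]
    proof eventually_elim
      case (elim u)
      have "exp ((1 - \<gamma>) * v) * ?x powr (\<gamma> - 1) = 1"
        by (simp add: powr_def algebra_simps flip: exp_add)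
      moreover have "\<phi> (u + v) / \<phi> u = exp ((1 - \<gamma>) * v) * (?D (exp u * ?x) / ?D (exp u))"
      proof -
        have "exp ((1 - \<gamma>) * (u + v)) = exp ((1 - \<gamma>) * u) * exp ((1 - \<gamma>) * v)"
          by (simp add: distrib_left exp_add)
        moreover have "0 < u + v" using elim by simp
        ultimately show ?thesis using elim by (simp add: \<phi>_def exp_add)
      qed
      ultimately show ?case
        by (simp add: right_diff_distrib)
    qed
    with lim show "((\<lambda>u. (\<phi> (u + v) / \<phi> u - 1) / A (exp u)) \<longlongrightarrow> (exp (\<rho> * v) - 1) / \<rho>) at_top"
      by (rule Lim_transform_eventually)
  qed
  then obtain C where C: "\<forall>\<^sub>F u in at_top. \<forall>x\<ge>0. \<bar>\<phi> (u + x) / \<phi> u - 1\<bar> \<le> C * \<bar>A (exp u)\<bar>" by blast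
  have "\<forall>\<^sub>F t in at_top. \<forall>x\<ge>0. \<bar>\<phi> (ln t + x) / \<phi> (ln t) - 1\<bar> \<le> C * \<bar>A (exp (ln t))\<bar>"
    using C ln_at_top by (rule eventually_compose_filterlim)
  then have "\<forall>\<^sub>F t in at_top. \<forall>T\<ge>0. \<bar>exp ((1 - \<gamma>) * T) * ?D (t * exp T) / ?D t - 1\<bar> \<le> C * \<bar>A t\<bar>"
    using eventually_gt_at_top[of 1]
  proof eventually_elim
    case (elim t)
    have "\<phi> (ln t + T) / \<phi> (ln t) = exp ((1 - \<gamma>) * T) * ?D (t * exp T) / ?D t" if "0 \<le> T" for T
      using elim(2) that deriv_tail_quantile_pos(1)[OF ev elim(2)]
        add_pos_nonneg[OF ln_gt_zero[OF elim(2)] that]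
      by (simp add: \<phi>_def exp_add distrib_left)
    then show ?case using elim by simp
  qed
  then show ?thesis by blast
qed

text \<open>The first part compares derivatives in T, those of \<open>gp_quantile\<close> being exp
  (\<gamma> T). The second part is for the error of the random threshold, which may fall on either
  side of V t.\<close>

lemma tail_quantile_expansion:
  assumes ev: "extreme_value_cond F \<gamma>" and so: "second_order_cond F \<gamma> \<rho> A"
  shows "\<exists>C. \<forall>\<^sub>F t in at_top.
    (\<forall>T\<ge>0. \<bar>(tail_quantile F (t * exp T) - tail_quantile F t) / tail_scale F t - gp_quantile \<gamma> T\<bar>
        \<le> C * \<bar>A t\<bar> * gp_quantile \<gamma> T)
    \<and> (\<forall>u. \<bar>u\<bar> \<le> 1 / 2 \<longrightarrow> \<bar>tail_quantile F (t * exp u) - tail_quantile F t\<bar>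
        \<le> 3 * exp \<bar>\<gamma>\<bar> * \<bar>u\<bar> * tail_scale F t)"
proof -
  let ?D = "deriv (tail_quantile F)" and ?V = "tail_quantile F"
  let ?r = "\<lambda>t T. exp ((1 - \<gamma>) * T) * ?D (t * exp T) / ?D t"
  obtain C where C: "\<forall>\<^sub>F t in at_top. \<forall>T\<ge>0. \<bar>?r t T - 1\<bar> \<le> C * \<bar>A t\<bar>"
    using deriv_tail_quantile_uniform[OF assms] by blast
  have "(A \<longlongrightarrow> 0) at_top" using so by (simp add: second_order_cond_def)
  then have "((\<lambda>t. C * \<bar>A t\<bar>) \<longlongrightarrow> C * \<bar>0\<bar>) at_top" by (intro tendsto_intros)
  then have "\<forall>\<^sub>F t in at_top. C * \<bar>A t\<bar> < 1 / 2" by (rule order_tendstoD(2)) simp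
  with C have "\<forall>\<^sub>F t in at_top. \<forall>T\<ge>0. \<bar>?r t T - 1\<bar> \<le> 1 / 2"
    by eventually_elim (meson less_imp_le order_trans)
  \<comment> \<open>The estimate for the derivative only looks forward from its base point.
    Restarting it at t / 2 also reaches t * exp u for negative u, because t * exp u = t / 2 * exp
    (ln 2 + u) and ln 2 >= 1 / 2.\<close>
  then have half: "\<forall>\<^sub>F t in at_top. \<forall>T\<ge>0. \<bar>?r (t / 2) T - 1\<bar> \<le> 1 / 2"
  proof (rule eventually_compose_filterlim)
    show "filterlim (\<lambda>t::real. t / 2) at_top at_top"
      using filterlim_tendsto_pos_mult_at_top[OF tendsto_const[of "1 / 2 :: real"] _ filterlim_ident]
      by simp
  qed
  show ?thesis
  proof (intro exI[of _ C])
    show "\<forall>\<^sub>F t in at_top.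
      (\<forall>T\<ge>0. \<bar>(?V (t * exp T) - ?V t) / tail_scale F t - gp_quantile \<gamma> T\<bar> \<le> C * \<bar>A t\<bar> * gp_quantile \<gamma> T)
      \<and> (\<forall>u. \<bar>u\<bar> \<le> 1 / 2 \<longrightarrow> \<bar>?V (t * exp u) - ?V t\<bar> \<le> 3 * exp \<bar>\<gamma>\<bar> * \<bar>u\<bar> * tail_scale F t)"
      using C half eventually_gt_at_top[of 2]
    proof eventually_elim
      case (elim t)
      define a where "a = tail_scale F t"
      have a: "a = t * ?D t" "a > 0" "?D t > 0"
        using deriv_tail_quantile_pos[OF ev, of t] elim(3) by (auto simp: a_def tail_scale_def)
      have "\<bar>(?V (t * exp T) - ?V t) / a - gp_quantile \<gamma> T\<bar> \<le> C * \<bar>A t\<bar> * gp_quantile \<gamma> T"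
        if T: "T \<ge> 0" for T
      proof -
        have "\<bar>(?V (t * exp T) / a - gp_quantile \<gamma> T) - (?V (t * exp 0) / a - gp_quantile \<gamma> 0)\<bar>
            \<le> C * \<bar>A t\<bar> * gp_quantile \<gamma> T - C * \<bar>A t\<bar> * gp_quantile \<gamma> 0"
        proof (rule abs_diff_le_if_deriv_le[OF T])
          fix x assume x: "0 \<le> x" "x \<le> T"
          have tx: "1 < t * exp x" using elim(3) x mult_mono[of 2 t 1 "exp x"] by simp
          show "((\<lambda>x. ?V (t * exp x) / a - gp_quantile \<gamma> x) has_real_derivative
              ?D (t * exp x) * (t * exp x) / a - exp (\<gamma> * x)) (at x)"
            using a by (auto intro!: derivative_eq_intros has_real_derivative_tail_quantile_exp[OF ev tx])
          show "((\<lambda>x. C * \<bar>A t\<bar> * gp_quantile \<gamma> x) has_real_derivative C * \<bar>A t\<bar> * exp (\<gamma> * x)) (at x)"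
            by (auto intro!: derivative_eq_intros)
          have "?D (t * exp x) * (t * exp x) / a = exp x * (?D (t * exp x) / ?D t)"
            using a elim(3) by simp
          also have "\<dots> = exp (\<gamma> * x) * ?r t x"
          proof -
            have e: "exp x = exp (\<gamma> * x) * exp ((1 - \<gamma>) * x)"
              by (simp add: algebra_simps flip: exp_add)
            have "exp x * d = exp (\<gamma> * x) * (exp ((1 - \<gamma>) * x) * d)" for d
              by (simp only: e mult.assoc)
            then show ?thesis by (simp only: times_divide_eq_right[symmetric])
          qed
          finally have "?D (t * exp x) * (t * exp x) / a - exp (\<gamma> * x) = exp (\<gamma> * x) * (?r t x - 1)"
            by (simp add: right_diff_distrib)
          then show "\<bar>?D (t * exp x) * (t * exp x) / a - exp (\<gamma> * x)\<bar> \<le> C * \<bar>A t\<bar> * exp (\<gamma> * x)"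
            using elim(1) x by (simp add: abs_mult mult.commute)
        qed
        then show ?thesis by (simp add: diff_divide_distrib algebra_simps)
      qed
      moreover have "\<bar>?V (t * exp u) - ?V t\<bar> \<le> 3 * exp \<bar>\<gamma>\<bar> * \<bar>u\<bar> * a"
        if u: "\<bar>u\<bar> \<le> 1 / 2" for u
      proof -
        let ?B = "3 * exp \<bar>\<gamma>\<bar> * a"
        have ln2: "ln 2 \<ge> (1 / 2 :: real)" using ln2_ge_two_thirds by simp
        have pos: "1 < t * exp x" if "\<bar>x\<bar> \<le> 1 / 2" for x
        proof -
          have "exp (- ln 2 :: real) \<le> exp x" unfolding exp_le_cancel_iff using that ln2 by linarith
          then have "1 / 2 \<le> exp x" by (simp add: exp_minus)
          then show ?thesis using mult_strict_right_mono[OF elim(3) exp_gt_zero[of x]] by linarith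
        qed
        \<comment> \<open>The factor 3 is the quotient of the bounds 3/2 and 1/2 for the ratio based
          at t / 2, taken at ln 2 + x and at ln 2.\<close>
        have D: "\<bar>?D (t * exp x) * (t * exp x)\<bar> \<le> ?B" if x: "\<bar>x\<bar> \<le> 1 / 2" for x
        proof -
          have D2: "?D (t / 2) > 0" using deriv_tail_quantile_pos(1)[OF ev, of "t / 2"] elim(3) by simp
          have r: "?r (t / 2) (ln 2 + x) \<le> 3 / 2" "?r (t / 2) (ln 2) \<ge> 1 / 2"
            using elim(2)[rule_format, of "ln 2 + x"] elim(2)[rule_format, of "ln 2"] x ln2
            unfolding abs_le_iff by linarith+
          have e2: "t / 2 * exp (ln 2 + x) = t * exp x" "t / 2 * exp (ln 2) = t"
            by (simp_all add: exp_add)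
          let ?c = "exp ((1 - \<gamma>) * ln 2)"
          have 1: "exp ((1 - \<gamma>) * x) * (?c * ?D (t * exp x)) \<le> 3 / 2 * ?D (t / 2)"
            using r(1) D2 unfolding e2 by (simp add: pos_divide_le_eq distrib_left exp_add mult_ac)
          have 2: "1 / 2 * ?D (t / 2) \<le> ?c * ?D t"
            using r(2) D2 unfolding e2 by (simp add: pos_le_divide_eq)
          have "?c * (exp ((1 - \<gamma>) * x) * ?D (t * exp x))
              = exp ((1 - \<gamma>) * x) * (?c * ?D (t * exp x))" by (rule mult.left_commute)
          also note 1
          also have "3 / 2 * ?D (t / 2) \<le> 3 * (?c * ?D t)" using 2 by linarith
          also have "\<dots> = ?c * (3 * ?D t)" by (rule mult.left_commute)
          finally have 3: "exp ((1 - \<gamma>) * x) * ?D (t * exp x) \<le> 3 * ?D t"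
            by (rule mult_left_le_imp_le) simp
          have "exp (\<gamma> * x) \<le> exp \<bar>\<gamma>\<bar>"
            using x mult_mono[of "\<bar>\<gamma>\<bar>" "\<bar>\<gamma>\<bar>" "\<bar>x\<bar>" 1] abs_ge_self[of "\<gamma> * x"] by (simp add: abs_mult)
          then have "exp (\<gamma> * x) * (exp ((1 - \<gamma>) * x) * ?D (t * exp x)) \<le> exp \<bar>\<gamma>\<bar> * (3 * ?D t)"
            using deriv_tail_quantile_pos(1)[OF ev pos[OF x]] by (intro mult_mono[OF _ 3]) auto
          also have "exp (\<gamma> * x) * (exp ((1 - \<gamma>) * x) * d) = exp x * d" for d
          proof -
            have "exp (\<gamma> * x) * exp ((1 - \<gamma>) * x) = exp x"
              by (simp add: algebra_simps flip: exp_add)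
            then show ?thesis by (simp only: mult.assoc[symmetric])
          qed
          finally have "t * (exp x * ?D (t * exp x)) \<le> t * (exp \<bar>\<gamma>\<bar> * (3 * ?D t))"
            using elim(3) by (intro mult_left_mono) auto
          then show ?thesis
            using deriv_tail_quantile_pos(1)[OF ev pos[OF x]] elim(3) by (simp add: a abs_mult mult_ac)
        qed
        note der = has_real_derivative_tail_quantile_exp[OF ev pos]
        have lin: "((\<lambda>x. ?B * x) has_real_derivative ?B) (at x)" for x
          by (auto intro!: derivative_eq_intros)
        show ?thesis
        proof (cases "0 \<le> u")
          case True
          have "\<bar>?V (t * exp u) - ?V (t * exp 0)\<bar> \<le> ?B * u - ?B * 0"
            by (rule abs_diff_le_if_deriv_le[OF True der lin D]) (use u in auto)
          then show ?thesis using True by (simp add: mult_ac)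
        next
          case False
          then have "u \<le> 0" by simp
          have "\<bar>?V (t * exp 0) - ?V (t * exp u)\<bar> \<le> ?B * 0 - ?B * u"
            by (rule abs_diff_le_if_deriv_le[OF \<open>u \<le> 0\<close> der lin D]) (use u in auto)
          then show ?thesis using False by (simp add: abs_minus_commute mult_ac)
        qed
      qed
      ultimately show ?case by (simp add: a_def)
    qed
  qed
qed

section \<open>Counts and order statistics of an i.i.d. sample\<close>

lemma card_eq_length_filter_sort:
  "card {i\<in>{..<n}. P (xs i)} = length (filter P (sort (map xs [0..<n])))"
proof -
  have "length (filter P (sort (map xs [0..<n]))) = size (filter_mset P (mset (map xs [0..<n])))"
    by (metis mset_filter mset_sort size_mset)
  also have "\<dots> = length (filter (\<lambda>i. P (xs i)) [0..<n])"
    by (metis (no_types, lifting) comp_apply filter_cong filter_map length_map mset_filter size_mset)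
  also have "\<dots> = card (set (filter (\<lambda>i. P (xs i)) [0..<n]))"
    by (rule distinct_card[symmetric]) simp
  also have "set (filter (\<lambda>i. P (xs i)) [0..<n]) = {i\<in>{..<n}. P (xs i)}" by auto
  finally show ?thesis by simp
qed

lemma card_less_if_order_stat_less:
  assumes "order_stat n xs j < v" "1 \<le> j" "j \<le> n"
  shows "j \<le> card {i\<in>{..<n}. xs i < v}"
proof -
  define L where "L = sort (map xs [0..<n])"
  have L: "sorted L" "length L = n" by (simp_all add: L_def)
  have "y < v" if y: "y \<in> set (take j L)" for y
  proof -
    obtain i where i: "i < j" "y = L ! i" using y L assms by (auto simp: in_set_conv_nth)
    then have "y \<le> L ! (j - 1)" using L assms by (auto intro: sorted_nth_mono)
    then show ?thesis using assms(1) by (simp add: order_stat_def L_def)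
  qed
  then have "filter (\<lambda>y. y < v) (take j L) = take j L" by (simp add: filter_id_conv)
  then have "j \<le> length (filter (\<lambda>y. y < v) (take j L @ drop j L))"
    using L assms unfolding filter_append by simp
  then show ?thesis
    using card_eq_length_filter_sort[of n "\<lambda>y. y < v" xs] by (simp add: L_def)
qed

lemma card_greater_if_order_stat_greater:
  assumes "v < order_stat n xs j" "1 \<le> j" "j \<le> n"
  shows "n - j + 1 \<le> card {i\<in>{..<n}. v < xs i}"
proof -
  define L where "L = sort (map xs [0..<n])"
  have L: "sorted L" "length L = n" by (simp_all add: L_def)
  have "v < y" if y: "y \<in> set (drop (j - 1) L)" for y
  proof -
    obtain i where "i < length (drop (j - 1) L)" "y = drop (j - 1) L ! i"
      using y by (metis in_set_conv_nth)
    then have i: "j - 1 + i < n" "y = L ! (j - 1 + i)" using L by auto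
    then have "L ! (j - 1) \<le> y" using L assms by (auto intro: sorted_nth_mono)
    then show ?thesis using assms(1) by (simp add: order_stat_def L_def)
  qed
  then have "filter (\<lambda>y. v < y) (drop (j - 1) L) = drop (j - 1) L" by (simp add: filter_id_conv)
  then have "n - j + 1 \<le> length (filter (\<lambda>y. v < y) (take (j - 1) L @ drop (j - 1) L))"
    using L assms unfolding filter_append by simp
  then show ?thesis
    using card_eq_length_filter_sort[of n "\<lambda>y. v < y" xs] by (simp add: L_def)
qed

section \<open>Binomial counts\<close>

locale iid_sample = prob_space M for M :: "'a measure" +
  fixes X :: "nat \<Rightarrow> 'a \<Rightarrow> real" and F :: "real \<Rightarrow> real"
  assumes indep: "indep_vars (\<lambda>_. borel) X UNIV"
    and cdf_X: "\<And>i. cdf (distr M borel (X i)) = F"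
    and continuous: "continuous_on UNIV F"
begin

lemma borel_measurable_X [measurable]: "X i \<in> borel_measurable M"
  using indep by (simp add: indep_vars_def)

lemma real_distribution_X: "real_distribution (distr M borel (X i))"
  by (simp add: real_distribution_distr)

sublocale continuous_cdf F
proof
  interpret D: real_distribution "distr M borel (X 0)" by (rule real_distribution_X)
  show "F x \<le> F y" if "x \<le> y" for x y
    using D.cdf_nondecreasing[OF that] by (simp add: cdf_X)
  show "continuous_on UNIV F" by (rule continuous)
  show "(F \<longlongrightarrow> 0) at_bot" using D.cdf_lim_at_bot by (simp add: cdf_X)
  show "(F \<longlongrightarrow> 1) at_top" using D.cdf_lim_at_top_prob by (simp add: cdf_X)
qed

lemma prob_greater: "prob {\<omega>\<in>space M. v < X i \<omega>} = 1 - F v"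
proof -
  have "F v = prob {\<omega>\<in>space M. X i \<omega> \<le> v}"
    unfolding cdf_X[of i, symmetric] cdf_def
    by (subst measure_distr) (auto intro!: arg_cong[where f = prob])
  moreover have "{\<omega>\<in>space M. v < X i \<omega>} = space M - {\<omega>\<in>space M. X i \<omega> \<le> v}" by auto
  ultimately show ?thesis by (simp add: prob_compl)
qed

lemma prob_ge: "prob {\<omega>\<in>space M. v \<le> X i \<omega>} = 1 - F v"
proof -
  interpret D: real_distribution "distr M borel (X i)" by (rule real_distribution_X)
  have "isCont F v" using continuous by (simp add: continuous_on_eq_continuous_at)
  then have "measure (distr M borel (X i)) {v} = 0" using D.isCont_cdf[of v] by (simp add: cdf_X)
  then have "prob {\<omega>\<in>space M. X i \<omega> = v} = 0"
    by (subst (asm) measure_distr) (auto simp: vimage_def Int_def conj_commute)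
  moreover have "prob {\<omega>\<in>space M. v \<le> X i \<omega>}
      = prob {\<omega>\<in>space M. v < X i \<omega>} + prob {\<omega>\<in>space M. X i \<omega> = v}"
    by (subst finite_measure_Union[symmetric]) (auto intro!: arg_cong[where f = prob])
  ultimately show ?thesis by (simp add: prob_greater)
qed

text \<open>By pairwise independence the mixed terms of the centred indicators vanish, and each
  diagonal term is p - p^2 <= p. Keeping p in the bound makes it useful for relative deviations at
  small p.\<close>

lemma count_Chebyshev:
  assumes S [measurable]: "S \<in> sets borel" and p: "\<And>i. prob {\<omega>\<in>space M. X i \<omega> \<in> S} = p"
    and a: "a > 0"
  shows "prob {\<omega>\<in>space M. a \<le> \<bar>real (card {i\<in>{..<n}. X i \<omega> \<in> S}) - real n * p\<bar>}
    \<le> real n * p / a\<^sup>2"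
proof -
  define Z where "Z i \<omega> = indicat_real S (X i \<omega>) - p" for i \<omega>
  have Zm [measurable]: "Z i \<in> borel_measurable M" for i
    unfolding Z_def by measurable
  have p01: "0 \<le> p" "p \<le> 1" using p[of 0] by (metis measure_nonneg, metis prob_le_1)
  have Zb: "\<bar>Z i \<omega>\<bar> \<le> 1" for i \<omega> using p01 by (auto simp: Z_def indicator_def)
  have ind: "integrable M (\<lambda>\<omega>. indicat_real S (X i \<omega>))" for i
    by (rule integrable_const_bound[where B = 1]) auto
  have Eind: "expectation (\<lambda>\<omega>. indicat_real S (X i \<omega>)) = p" for i
  proof -
    have "expectation (\<lambda>\<omega>. indicat_real S (X i \<omega>)) = expectation (indicat_real {\<omega>\<in>space M. X i \<omega> \<in> S})"
      by (intro Bochner_Integration.integral_cong) (auto simp: indicator_def)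
    then show ?thesis using p by simp
  qed
  have iZ: "integrable M (Z i)" for i
    by (rule integrable_const_bound[where B = 1]) (use Zb in auto)
  have EZ: "expectation (Z i) = 0" for i
    unfolding Z_def using ind Eind by (simp add: prob_space)
  have iZZ: "integrable M (\<lambda>\<omega>. Z i \<omega> * Z j \<omega>)" for i j
  proof (rule integrable_const_bound[where B = 1])
    have "\<bar>Z i \<omega> * Z j \<omega>\<bar> \<le> 1 * 1" for \<omega>
      unfolding abs_mult using Zb by (intro mult_mono) auto
    then show "AE \<omega> in M. norm (Z i \<omega> * Z j \<omega>) \<le> 1" by simp
  qed simp
  have E_diag: "expectation (\<lambda>\<omega>. Z i \<omega> * Z i \<omega>) \<le> p" for i
  proof -
    have "Z i \<omega> * Z i \<omega> = (1 - 2 * p) * indicat_real S (X i \<omega>) + p\<^sup>2" for \<omega>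
      by (auto simp: Z_def indicator_def power2_eq_square algebra_simps)
    then have "expectation (\<lambda>\<omega>. Z i \<omega> * Z i \<omega>) = (1 - 2 * p) * p + p\<^sup>2"
      using ind Eind by (simp add: prob_space)
    also have "\<dots> = p - p\<^sup>2" by (simp add: power2_eq_square algebra_simps)
    finally show ?thesis by simp
  qed
  have E_off: "expectation (\<lambda>\<omega>. Z i \<omega> * Z j \<omega>) = 0" if "i \<noteq> j" for i j
  proof -
    have "indep_vars (\<lambda>_. borel) (\<lambda>i \<omega>. indicat_real S (X i \<omega>) - p) {i, j}"
      by (intro indep_vars_compose2[OF indep_vars_subset[OF indep]]) auto
    then have "indep_vars (\<lambda>_. borel) Z {i, j}" by (simp add: Z_def[abs_def])
    then have "expectation (\<lambda>\<omega>. \<Prod>l\<in>{i, j}. Z l \<omega>) = (\<Prod>l\<in>{i, j}. expectation (Z l))"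
      using iZ by (intro indep_vars_lebesgue_integral) auto
    then show ?thesis using that EZ by simp
  qed
  define f where "f \<omega> = (\<Sum>i<n. Z i \<omega>)" for \<omega>
  have f2: "(f \<omega>)\<^sup>2 = (\<Sum>i<n. \<Sum>j<n. Z i \<omega> * Z j \<omega>)" for \<omega>
    by (simp add: f_def power2_eq_square sum_product)
  have if2: "integrable M (\<lambda>\<omega>. (f \<omega>)\<^sup>2)"
    unfolding f2 by (intro Bochner_Integration.integrable_sum iZZ)
  have "expectation (\<lambda>\<omega>. (f \<omega>)\<^sup>2) = (\<Sum>i<n. \<Sum>j<n. expectation (\<lambda>\<omega>. Z i \<omega> * Z j \<omega>))"
    unfolding f2 by (simp add: Bochner_Integration.integral_sum iZZ)
  also have "\<dots> \<le> (\<Sum>i<n. \<Sum>j<n. if i = j then p else 0)"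
    using E_diag E_off by (intro sum_mono) auto
  also have "\<dots> = real n * p" by simp
  finally have Ef2: "expectation (\<lambda>\<omega>. (f \<omega>)\<^sup>2) \<le> real n * p" .
  have "f \<omega> = real (card {i\<in>{..<n}. X i \<omega> \<in> S}) - real n * p" for \<omega>
    by (simp add: f_def Z_def sum_subtractf indicator_def sum.If_cases Int_def)
  moreover have "prob {\<omega>\<in>space M. a \<le> \<bar>f \<omega>\<bar>} \<le> expectation (\<lambda>\<omega>. (f \<omega>)\<^sup>2) / a\<^sup>2"
    by (rule second_moment_method) (use if2 a in \<open>auto simp: f_def\<close>)
  ultimately have "prob {\<omega>\<in>space M. a \<le> \<bar>real (card {i\<in>{..<n}. X i \<omega> \<in> S}) - real n * p\<bar>}
      \<le> expectation (\<lambda>\<omega>. (f \<omega>)\<^sup>2) / a\<^sup>2" by simp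
  also have "\<dots> \<le> real n * p / a\<^sup>2" using Ef2 by (intro divide_right_mono) auto
  finally show ?thesis .
qed

lemma count_measurable [measurable]:
  assumes [measurable]: "S \<in> sets borel"
  shows "(\<lambda>\<omega>. real (card {i\<in>{..<n}. X i \<omega> \<in> S})) \<in> borel_measurable M"
proof -
  have "(\<lambda>\<omega>. real (card {i\<in>{..<n}. X i \<omega> \<in> S})) = (\<lambda>\<omega>. \<Sum>i<n. indicat_real S (X i \<omega>))"
    by (simp add: indicator_def sum.If_cases Int_def)
  then show ?thesis by simp
qed

text \<open>A threshold above the upper quantile forces at least k + 1 observations beyond it, where
  k exp (-u) <= k (1 - u / 2) are expected. One below the lower quantile leaves at most k
  observations at or above it, where k exp u >= k (1 + u) are expected. Each deviation costs 4 / (k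
  u^2).\<close>

lemma order_stat_near_quantile:
  fixes n k :: nat and u :: real
  defines "t \<equiv> real n / real k"
  assumes k: "0 < k" "k < n" and u: "0 < u" "u \<le> 1 / 2" "1 < t * exp (- u)"
  shows "\<exists>B\<in>events. prob B \<le> 8 / (real k * u\<^sup>2) \<and> (\<forall>\<omega>\<in>space M - B.
    tail_quantile F (t * exp (- u)) \<le> order_stat n (\<lambda>i. X i \<omega>) (n - k) \<and>
    order_stat n (\<lambda>i. X i \<omega>) (n - k) \<le> tail_quantile F (t * exp u))"
proof -
  have n: "0 < n" using k by simp
  define v1 v2 where "v1 = tail_quantile F (t * exp u)" and "v2 = tail_quantile F (t * exp (- u))"
  have t0: "0 < t" using k by (simp add: t_def)
  have "t * exp (- u) \<le> t * exp u" using t0 u by simp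
  then have "1 < t * exp u" using u by linarith
  then have F1: "real n * (1 - F v1) = real k * exp (- u)"
    using k n by (simp add: v1_def F_tail_quantile t_def exp_minus field_simps)
  have F2: "real n * (1 - F v2) = real k * exp u"
    using k n u(3) by (simp add: v2_def F_tail_quantile t_def exp_minus field_simps)
  let ?N1 = "\<lambda>\<omega>. real (card {i\<in>{..<n}. X i \<omega> \<in> {v1<..}})"
  let ?N2 = "\<lambda>\<omega>. real (card {i\<in>{..<n}. X i \<omega> \<in> {v2..}})"
  define B1 where "B1 = {\<omega>\<in>space M. real k * u / 2 \<le> \<bar>?N1 \<omega> - real n * (1 - F v1)\<bar>}"
  define B2 where "B2 = {\<omega>\<in>space M. real k * u \<le> \<bar>?N2 \<omega> - real n * (1 - F v2)\<bar>}"
  have meas: "B1 \<in> events" "B2 \<in> events" unfolding B1_def B2_def by measurable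
  have "prob B1 \<le> real n * (1 - F v1) / (real k * u / 2)\<^sup>2"
    unfolding B1_def by (rule count_Chebyshev) (use k u prob_greater in auto)
  also have "\<dots> \<le> real k / (real k * u / 2)\<^sup>2"
    unfolding F1 using u by (intro divide_right_mono) (auto intro: mult_left_le)
  also have "\<dots> = 4 / (real k * u\<^sup>2)" using k by (simp add: power2_eq_square field_simps)
  finally have pB1: "prob B1 \<le> 4 / (real k * u\<^sup>2)" .
  have eu: "exp u \<le> 2" using exp_bound_half[of u] u by simp
  have "prob B2 \<le> real n * (1 - F v2) / (real k * u)\<^sup>2"
    unfolding B2_def by (rule count_Chebyshev) (use k u prob_ge in auto)
  also have "\<dots> \<le> real k * 2 / (real k * u)\<^sup>2"
    unfolding F2 using eu by (intro divide_right_mono mult_left_mono) auto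
  also have "\<dots> \<le> 4 / (real k * u\<^sup>2)" using k u by (simp add: power2_eq_square field_simps)
  finally have pB2: "prob B2 \<le> 4 / (real k * u\<^sup>2)" .
  show ?thesis
  proof (intro bexI[of _ "B1 \<union> B2"] conjI ballI)
    show "prob (B1 \<union> B2) \<le> 8 / (real k * u\<^sup>2)"
      using order_trans[OF measure_Un_le[OF meas] add_mono[OF pB1 pB2]] by simp
    fix \<omega> assume \<omega>: "\<omega> \<in> space M - (B1 \<union> B2)"
    let ?b = "order_stat n (\<lambda>i. X i \<omega>) (n - k)"
    show "?b \<le> tail_quantile F (t * exp u)"
    proof (rule ccontr)
      assume "\<not> ?thesis"
      then have "v1 < ?b" by (simp add: v1_def)
      from card_greater_if_order_stat_greater[OF this] k
      have "k + 1 \<le> card {i\<in>{..<n}. v1 < X i \<omega>}" by simp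
      then have N: "real k + 1 \<le> ?N1 \<omega>" by simp
      have "exp (- u) \<le> 1 - u / 2"
      proof -
        have "(1 - u / 2) * exp u \<ge> (1 - u / 2) * (1 + u)"
          using u exp_ge_add_one_self[of u] by (intro mult_left_mono) auto
        moreover have "(1 - u / 2) * (1 + u) \<ge> 1"
          using mult_left_mono[of u 1 u] u by (simp add: algebra_simps)
        ultimately show ?thesis by (simp add: exp_minus field_simps)
      qed
      then have "real k * exp (- u) \<le> real k * (1 - u / 2)" by (intro mult_left_mono) auto
      then have "real k * u / 2 \<le> ?N1 \<omega> - real n * (1 - F v1)"
        using N unfolding F1 by (simp add: algebra_simps)
      from order_trans[OF this abs_ge_self] show False using \<omega> by (auto simp: B1_def)
    qed
    show "tail_quantile F (t * exp (- u)) \<le> ?b"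
    proof (rule ccontr)
      assume "\<not> ?thesis"
      then have "?b < v2" by (simp add: v2_def)
      from card_less_if_order_stat_less[OF this] k
      have "n - k \<le> card {i\<in>{..<n}. X i \<omega> < v2}" by simp
      moreover have "card {i\<in>{..<n}. X i \<omega> < v2} + card {i\<in>{..<n}. v2 \<le> X i \<omega>} = n"
      proof -
        have "card ({i\<in>{..<n}. X i \<omega> < v2} \<union> {i\<in>{..<n}. v2 \<le> X i \<omega>}) = card {..<n}"
          by (intro arg_cong[where f = card]) auto
        then show ?thesis by (subst (asm) card_Un_disjoint) auto
      qed
      ultimately have "card {i\<in>{..<n}. v2 \<le> X i \<omega>} \<le> k" using k by linarith
      then have N: "?N2 \<omega> \<le> real k" by simp
      have "real k * (1 + u) \<le> real k * exp u" by (intro mult_left_mono exp_ge_add_one_self) auto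
      then have "real k * u \<le> - (?N2 \<omega> - real n * (1 - F v2))"
        using N unfolding F2 by (simp add: algebra_simps)
      from order_trans[OF this abs_ge_minus_self] show False using \<omega> by (auto simp: B2_def)
    qed
  qed (use meas in auto)
qed

text \<open>Chebyshev on a geometric grid of levels and monotonicity between the grid points.\<close>

lemma empirical_survival_ratio:
  fixes n :: nat and c \<epsilon> :: real
  assumes n: "0 < n" and c: "0 < c" and \<epsilon>: "0 < \<epsilon>" "\<epsilon> \<le> 1"
  shows "\<exists>B\<in>events. prob B \<le> 4 / (\<epsilon> ^ 3 * (real n * c)) \<and> (\<forall>\<omega>\<in>space M - B. \<forall>x. c \<le> 1 - F x \<longrightarrow>
    \<bar>real (card {i\<in>{..<n}. x \<le> X i \<omega>}) / real n / (1 - F x) - 1\<bar> \<le> 3 * \<epsilon>)"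
proof -
  \<comment> \<open>Starting at c / 2 puts a grid level strictly below every level q >= c.\<close>
  define p where "p j = c / 2 * (1 + \<epsilon>) ^ j" for j
  define v where "v j = tail_quantile F (1 / p j)" for j
  let ?N = "\<lambda>x \<omega>. real (card {i\<in>{..<n}. X i \<omega> \<in> {x..}})"
  define E where "E j = {\<omega>\<in>space M. \<epsilon> * (real n * p j) \<le> \<bar>?N (v j) \<omega> - real n * p j\<bar>}" for j
  \<comment> \<open>Levels of at least 1 have no quantile; there the count is bounded by n
    instead.\<close>
  define J where "J = {j. p j < 1}"
  have p0: "0 < p j" for j using c \<epsilon> by (simp add: p_def)
  have p_Suc: "p (Suc j) = (1 + \<epsilon>) * p j" for j by (simp add: p_def)
  have Fv: "1 - F (v j) = p j" if "j \<in> J" for j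
    using that p0[of j] by (simp add: v_def F_tail_quantile J_def)
  have large: "\<exists>m. b \<le> p m" for b
  proof -
    obtain m where "2 * b / c < (1 + \<epsilon>) ^ m" using real_arch_pow[of "1 + \<epsilon>"] \<epsilon> by auto
    then have "b \<le> p m" using c by (simp add: p_def field_simps)
    then show ?thesis by blast
  qed
  obtain m where m: "1 \<le> p m" using large by blast
  have "j < m" if "j \<in> J" for j
  proof (rule ccontr)
    assume "\<not> j < m"
    then have "p m \<le> p j" using c \<epsilon> by (auto simp: p_def intro!: mult_left_mono power_increasing)
    with m that show False by (simp add: J_def)
  qed
  then have Jm: "J \<subseteq> {..<m}" by auto
  then have J: "finite J" by (rule finite_subset) simp
  have E: "E j \<in> events" for j unfolding E_def by measurable
  \<comment> \<open>The bound for a relative deviation decays geometrically as the level rises, so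
    the union over the grid costs only the factor 2 / \<epsilon> over the bound at the lowest
    level.\<close>
  have pE: "prob (E j) \<le> 2 / (\<epsilon>\<^sup>2 * (real n * c)) * (1 / (1 + \<epsilon>)) ^ j" if "j \<in> J" for j
  proof -
    have "prob (E j) \<le> real n * p j / (\<epsilon> * (real n * p j))\<^sup>2"
      unfolding E_def using prob_ge[of "v j"] Fv[OF that] n p0[of j] \<epsilon>
      by (intro count_Chebyshev) auto
    also have "\<dots> = 1 / (\<epsilon>\<^sup>2 * (real n * p j))"
      using n p0[of j] \<epsilon> by (simp add: power2_eq_square field_simps)
    also have "\<dots> = 2 / (\<epsilon>\<^sup>2 * (real n * c)) * (1 / (1 + \<epsilon>)) ^ j"
      by (simp add: p_def power_one_over field_simps)
    finally show ?thesis .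
  qed
  define B where "B = (\<Union>j\<in>J. E j)"
  have "prob B \<le> (\<Sum>j\<in>J. prob (E j))"
    unfolding B_def using E J by (intro finite_measure_subadditive_finite) auto
  also have "\<dots> \<le> (\<Sum>j\<in>J. 2 / (\<epsilon>\<^sup>2 * (real n * c)) * (1 / (1 + \<epsilon>)) ^ j)"
    using pE by (rule sum_mono)
  also have "\<dots> \<le> (\<Sum>j<m. 2 / (\<epsilon>\<^sup>2 * (real n * c)) * (1 / (1 + \<epsilon>)) ^ j)"
    using Jm c \<epsilon> by (intro sum_mono2) auto
  also have "\<dots> = 2 / (\<epsilon>\<^sup>2 * (real n * c)) * (\<Sum>j<m. (1 / (1 + \<epsilon>)) ^ j)"
    by (simp add: sum_distrib_left)
  also have "\<dots> \<le> 2 / (\<epsilon>\<^sup>2 * (real n * c)) * (2 / \<epsilon>)"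
  proof (rule mult_left_mono)
    let ?q = "1 / (1 + \<epsilon>)"
    have q: "0 < ?q" "?q < 1" using \<epsilon> by auto
    have "(\<Sum>j<m. ?q ^ j) = (1 - ?q ^ m) / (1 - ?q)" using q by (simp add: sum_gp_strict)
    also have "\<dots> \<le> 1 / (1 - ?q)" using q by (intro divide_right_mono) auto
    also have "\<dots> = (1 + \<epsilon>) / \<epsilon>" using \<epsilon> by (simp add: field_simps)
    also have "\<dots> \<le> 2 / \<epsilon>" using \<epsilon> by (intro divide_right_mono) auto
    finally show "(\<Sum>j<m. ?q ^ j) \<le> 2 / \<epsilon>" .
  qed (use c in auto)
  also have "\<dots> = 4 / (\<epsilon> ^ 3 * (real n * c))"
    by (simp add: power2_eq_square power3_eq_cube)
  finally have pB: "prob B \<le> 4 / (\<epsilon> ^ 3 * (real n * c))" .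
  show ?thesis
  proof (intro bexI[of _ B] conjI ballI allI impI pB)
    show "B \<in> events" unfolding B_def using E J by auto
    fix \<omega> x assume \<omega>: "\<omega> \<in> space M - B" and x: "c \<le> 1 - F x"
    define q where "q = 1 - F x"
    have N_mono: "?N y \<omega> \<le> ?N x \<omega>" if "x \<le> y" for x y
      using that by (auto intro!: card_mono)
    have q0: "0 < q" "q \<le> 1"
    proof -
      show "0 < q" using x c by (simp add: q_def)
      have "0 \<le> F x" using prob_ge[of x 0] prob_le_1[of "{\<omega>\<in>space M. x \<le> X 0 \<omega>}"] by simp
      then show "q \<le> 1" by (simp add: q_def)
    qed
    \<comment> \<open>Least, so that q lies between two consecutive levels with quotient 1 +
      \<epsilon>. The count is squeezed with factors (1 + \<epsilon>)^2 <= 1 + 3 \<epsilon> and (1 -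
      \<epsilon>) / (1 + \<epsilon>) >= 1 - 2 \<epsilon>.\<close>
    define l where "l = (LEAST l. q \<le> p l)"
    have l: "q \<le> p l" unfolding l_def using large by (rule LeastI_ex)
    have "l \<noteq> 0"
    proof
      assume "l = 0"
      then have "q \<le> c / 2" using l by (simp add: p_def)
      then show False using x c by (simp add: q_def)
    qed
    then obtain j where j: "l = Suc j" by (cases l) auto
    then have pj: "p j < q" using not_less_Least[of j "\<lambda>l. q \<le> p l"] by (simp add: l_def)
    have good: "\<bar>?N (v i) \<omega> - real n * p i\<bar> < \<epsilon> * (real n * p i)" if "i \<in> J" for i
      using \<omega> that by (auto simp: B_def E_def not_le)
    have jJ: "j \<in> J" using pj q0 by (simp add: J_def)
    have "\<not> v j \<le> x" using pj mono[of "v j" x] Fv[OF jJ] by (auto simp: q_def)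
    then have lower: "(1 - \<epsilon>) * (real n * p j) \<le> ?N x \<omega>"
      using good[OF jJ] N_mono[of x "v j"] by (simp add: algebra_simps)
    have upper: "?N x \<omega> \<le> (1 + \<epsilon>) * (real n * p l)"
    proof (cases "l \<in> J")
      case True
      have "v l \<le> x"
        unfolding v_def using l True p0[of l] by (subst tail_quantile_le_iff) (auto simp: J_def q_def)
      then show ?thesis using good[OF True] N_mono[of "v l" x] by (simp add: algebra_simps)
    next
      case False
      then have "1 \<le> p l" by (simp add: J_def)
      have "?N x \<omega> \<le> real n" using card_mono[of "{..<n}" "{i\<in>{..<n}. X i \<omega> \<in> {x..}}"] by auto
      also have "\<dots> \<le> real n * p l" using \<open>1 \<le> p l\<close> n by simp
      also have "\<dots> \<le> (1 + \<epsilon>) * (real n * p l)" using \<epsilon> p0[of l] by (simp add: algebra_simps)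
      finally show ?thesis .
    qed
    have nq: "0 < real n * q" using n q0 by simp
    have "?N x \<omega> \<le> (1 + \<epsilon>) * (real n * ((1 + \<epsilon>) * p j))" using upper by (simp add: j p_Suc)
    also have "\<dots> \<le> (1 + \<epsilon>) * (real n * ((1 + \<epsilon>) * q))"
      using pj \<epsilon> by (intro mult_left_mono) auto
    also have "\<dots> = (1 + \<epsilon>)\<^sup>2 * (real n * q)" by (simp add: power2_eq_square)
    also have "\<dots> \<le> (1 + 3 * \<epsilon>) * (real n * q)"
      using nq \<epsilon> mult_left_mono[of \<epsilon> 1 \<epsilon>]
      by (intro mult_right_mono) (auto simp: power2_eq_square algebra_simps)
    finally have up: "?N x \<omega> \<le> (1 + 3 * \<epsilon>) * (real n * q)" .
    have "q \<le> (1 + \<epsilon>) * p j" using l by (simp add: j p_Suc)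
    then have "(1 - 2 * \<epsilon>) * (real n * q) \<le> (1 - \<epsilon>) * (real n * p j)"
    proof -
      have "(1 - 2 * \<epsilon>) * q \<le> (1 - \<epsilon>) * p j"
      proof (cases "1 - 2 * \<epsilon> \<le> 0")
        case True
        then have "(1 - 2 * \<epsilon>) * q \<le> 0" using q0 by (simp add: mult_nonpos_nonneg)
        also have "0 \<le> (1 - \<epsilon>) * p j" using \<epsilon> p0[of j] by simp
        finally show ?thesis .
      next
        case False
        then have "(1 - 2 * \<epsilon>) * q \<le> (1 - 2 * \<epsilon>) * ((1 + \<epsilon>) * p j)"
          using \<open>q \<le> (1 + \<epsilon>) * p j\<close> by (intro mult_left_mono) auto
        also have "\<dots> = (1 - \<epsilon> - 2 * \<epsilon> * \<epsilon>) * p j" by (simp add: algebra_simps)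
        also have "\<dots> \<le> (1 - \<epsilon>) * p j" using p0[of j] \<epsilon> by (intro mult_right_mono) auto
        finally show ?thesis .
      qed
      from mult_left_mono[OF this, of "real n"] show ?thesis by (simp add: mult_ac)
    qed
    with lower have lo: "(1 - 2 * \<epsilon>) * (real n * q) \<le> ?N x \<omega>" by linarith
    have "?N x \<omega> / (real n * q) \<le> 1 + 3 * \<epsilon>" "1 - 2 * \<epsilon> \<le> ?N x \<omega> / (real n * q)"
      using up lo nq by (simp_all add: pos_divide_le_eq pos_le_divide_eq)
    then show "\<bar>real (card {i\<in>{..<n}. x \<le> X i \<omega>}) / real n / (1 - F x) - 1\<bar> \<le> 3 * \<epsilon>"
      using \<epsilon> by (simp add: q_def abs_le_iff divide_divide_eq_left)
  qed
qed

end

section \<open>One tail\<close>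

text \<open>For nonnegative arguments the base can fail to be positive only if g < 0, and then both
  values are cut off to 0.\<close>

lemma gp_tail_antimono_nonneg:
  assumes "0 \<le> y1" "y1 \<le> y2"
  shows "gp_tail g y2 \<le> gp_tail g y1"
proof (cases "1 + g * y1 > 0")
  case True
  then show ?thesis using assms gp_tail_antimono by blast
next
  case False
  then have g: "g < 0" using assms(1) by (smt (verit) mult_nonneg_nonneg)
  then have "g * y2 \<le> g * y1" using assms by (simp add: mult_left_mono_neg)
  then have "1 + g * y2 \<le> 0" "1 + g * y1 \<le> 0" using False by simp_all
  then show ?thesis using g by (simp add: gp_tail_def max_def)
qed

text \<open>In units of the true scale, v is the excess over V t, s the error of the location and q
  the ratio of estimated to true scale. The factor 2 comes from q >= 1 / 2.\<close>

lemma excess_error: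
  fixes v s q G :: real
  assumes G: "0 \<le> G" and r: "0 \<le> r" "r \<le> 1" and C: "0 \<le> C1" "0 \<le> C2" "0 \<le> C3"
    and v: "\<bar>v - G\<bar> \<le> C1 * r * G" and s: "\<bar>s\<bar> \<le> C2 * r"
    and q: "\<bar>q - 1\<bar> \<le> C3 * r" "C3 * r \<le> 1 / 2"
  shows "\<bar>(v - s) / q - G\<bar> \<le> 2 * (C1 + C2 + C3) * r * (1 + G)"
proof -
  have q': "1 / 2 \<le> q" using q by linarith
  have "\<bar>(v - s) - q * G\<bar> \<le> \<bar>v - G\<bar> + \<bar>s\<bar> + \<bar>q - 1\<bar> * G"
    using G by (simp add: abs_mult[of "q - 1" G, symmetric, simplified abs_of_nonneg[OF G]] left_diff_distrib)
  also have "\<dots> \<le> C1 * r * G + C2 * r + C3 * r * G"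
    by (intro add_mono v s mult_right_mono q G)
  also have "\<dots> \<le> (C1 + C2 + C3) * r * (1 + G)"
    using G r C by (simp add: algebra_simps)
  finally have *: "\<bar>(v - s) - q * G\<bar> \<le> (C1 + C2 + C3) * r * (1 + G)" .
  have "(v - s) / q - G = ((v - s) - q * G) / q" using q' by (simp add: field_simps)
  then have "\<bar>(v - s) / q - G\<bar> = \<bar>(v - s) - q * G\<bar> / q" using q' by simp
  also have "\<dots> \<le> \<bar>(v - s) - q * G\<bar> / (1 / 2)" using q' by (intro divide_left_mono) auto
  also have "\<dots> \<le> 2 * ((C1 + C2 + C3) * r * (1 + G))" using * by simp
  finally show ?thesis by (simp only: mult.assoc)
qed

lemma (in prob_space) bounded_in_probD:
  assumes "bounded_in_prob M Y" "0 < \<epsilon>" and [measurable]: "\<And>n. Y n \<in> borel_measurable M"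
  obtains C where "0 < C" "\<forall>\<^sub>F n in sequentially. prob {\<omega>\<in>space M. \<bar>Y n \<omega>\<bar> > C} \<le> \<epsilon>"
proof -
  obtain C where C: "\<forall>\<^sub>F n in sequentially. prob {\<omega>\<in>space M. \<bar>Y n \<omega>\<bar> > C} \<le> \<epsilon>"
    using assms unfolding bounded_in_prob_def by blast
  have "\<forall>\<^sub>F n in sequentially. prob {\<omega>\<in>space M. \<bar>Y n \<omega>\<bar> > max 1 C} \<le> \<epsilon>"
    using C
  proof eventually_elim
    case (elim n)
    have "prob {\<omega>\<in>space M. \<bar>Y n \<omega>\<bar> > max 1 C} \<le> prob {\<omega>\<in>space M. \<bar>Y n \<omega>\<bar> > C}"
      by (intro finite_measure_mono) auto
    with elim show ?case by simp
  qed
  then show ?thesis by (intro that[of "max 1 C"]) auto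
qed

text \<open>For points between the random threshold and V t: the tail value at y lies between its
  value at y0, which is close to 1, and its value 1 at 0, while exp T is within u of 1.\<close>

lemma exp_gp_tail_below:
  assumes "- u \<le> T" "T \<le> 0" "0 \<le> y" "y \<le> y0" "0 \<le> u" "0 \<le> \<eta>"
    and "\<bar>gp_tail g y0 - 1\<bar> \<le> \<eta>"
  shows "\<bar>exp T * gp_tail g y - 1\<bar> \<le> \<eta> + u"
proof -
  let ?p = "gp_tail g y"
  have p: "1 - \<eta> \<le> ?p" "?p \<le> 1" "0 \<le> ?p"
    using gp_tail_antimono_nonneg[OF assms(3,4), of g] gp_tail_antimono_nonneg[OF order_refl assms(3), of g] assms
    by (auto simp: gp_tail_def abs_le_iff)
  have e: "1 - u \<le> exp T" "exp T \<le> 1"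
    using order_trans[OF _ exp_ge_add_one_self[of T], of "1 - u"] assms by simp_all
  have "exp T * ?p \<le> 1" using p e by (intro mult_le_one) auto
  moreover have "1 - \<eta> - u \<le> exp T * ?p"
  proof -
    have "(1 - exp T) * ?p \<le> 1 - exp T" using p e by (simp add: mult_left_le)
    then show ?thesis using p e by (simp add: left_diff_distrib)
  qed
  ultimately show ?thesis using assms by (simp add: abs_le_iff)
qed

context iid_sample
begin

text \<open>Both regimes share one exceptional event. The clause 1 / 2 < F x tells which term of the
  minimum is the depth. The second regime covers everything left of the threshold, so the central
  part can take its two factors from the two tails.\<close>

lemma one_sided:
  fixes k :: "nat \<Rightarrow> nat" and \<delta> :: "nat \<Rightarrow> real" and \<Gamma> \<Delta> :: "nat \<Rightarrow> 'a \<Rightarrow> real"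
    and A :: "real \<Rightarrow> real"
  assumes k: "\<forall>n\<ge>3. 0 < k n \<and> real (k n) < real n / 2"
    and k_top: "filterlim k at_top sequentially"
    and k_n: "(\<lambda>n. real (k n) / real n) \<longlonglongrightarrow> 0"
    and \<delta>: "\<And>n. 0 < \<delta> n \<and> \<delta> n < 1 / 2"
    and n\<delta>: "(\<lambda>n. real n * \<delta> n) \<longlonglongrightarrow> 0"
    and meas [measurable]: "\<And>n. \<Gamma> n \<in> borel_measurable M" "\<And>n. \<Delta> n \<in> borel_measurable M"
    and ev: "extreme_value_cond F \<gamma>" and so: "second_order_cond F \<gamma> \<rho> A"
    and A: "(\<lambda>n. sqrt (real (k n)) * A (real n / real (k n))) \<longlonglongrightarrow> \<Lambda>"
    and \<Gamma>: "bounded_in_prob M (\<lambda>n \<omega>. sqrt (real (k n)) * (\<Gamma> n \<omega> - \<gamma>))"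
    and \<Delta>: "bounded_in_prob M (\<lambda>n \<omega>. sqrt (real (k n)) *
           (\<Delta> n \<omega> / tail_scale F (real n / real (k n)) - 1))"
    and w: "(\<lambda>n. w \<gamma> (real (k n) / (real n * \<delta> n)) / sqrt (real (k n))) \<longlonglongrightarrow> 0"
    and \<epsilon>: "0 < \<epsilon>" and \<eta>: "0 < \<eta>" "\<eta> \<le> 1"
  shows "\<forall>\<^sub>F n in sequentially. \<exists>B\<in>events. prob B \<le> \<epsilon> \<and> (\<forall>\<omega>\<in>space M - B.
    (\<forall>x. order_stat n (\<lambda>i. X i \<omega>) (n - k n) \<le> x \<longrightarrow> \<delta> n \<le> 1 - F x \<longrightarrow> 1 / 2 < F x \<and>
      \<bar>right_tail_est n (k n) (\<Gamma> n \<omega>) (\<Delta> n \<omega>) (\<lambda>i. X i \<omega>) x / (1 - F x) - 1\<bar> \<le> \<eta>) \<and>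
    (\<forall>x. x < order_stat n (\<lambda>i. X i \<omega>) (n - k n) \<longrightarrow> 0 < 1 - F x \<and>
      \<bar>real (card {i\<in>{..<n}. x \<le> X i \<omega>}) / real n / (1 - F x) - 1\<bar> \<le> \<eta>))"
proof -
  let ?V = "tail_quantile F"
  define r where "r n = 1 / sqrt (real (k n))" for n
  define t where "t n = real n / real (k n)" for n
  define a where "a n = tail_scale F (t n)" for n
  have k_real: "filterlim (\<lambda>n. real (k n)) at_top sequentially"
    using k_top filterlim_real_sequentially by (rule filterlim_compose[rotated])
  have kpos: "\<forall>\<^sub>F n in sequentially. 3 \<le> n \<and> 0 < k n \<and> real (k n) < real n / 2"
    using eventually_ge_at_top[of 3] by eventually_elim (use k in auto)
  have r0: "r \<longlonglongrightarrow> 0"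
    unfolding r_def[abs_def]
    by (intro tendsto_divide_0[OF tendsto_const] filterlim_at_top_imp_at_infinity
        filterlim_compose[OF sqrt_at_top k_real])
  have t_top: "filterlim t at_top sequentially"
  proof -
    have "filterlim (\<lambda>n. inverse (real (k n) / real n)) at_top sequentially"
      using kpos by (intro filterlim_inverse_at_top k_n) (auto elim: eventually_mono)
    then show ?thesis by (simp add: t_def[abs_def])
  qed

  obtain C\<gamma> where C\<gamma>: "0 < C\<gamma>"
    "\<forall>\<^sub>F n in sequentially. prob {\<omega>\<in>space M. \<bar>sqrt (real (k n)) * (\<Gamma> n \<omega> - \<gamma>)\<bar> > C\<gamma>} \<le> \<epsilon> / 4"
    by (rule bounded_in_probD[OF \<Gamma>, of "\<epsilon> / 4"]) (use \<epsilon> in auto)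
  obtain Ca where Ca: "0 < Ca"
    "\<forall>\<^sub>F n in sequentially. prob {\<omega>\<in>space M.
      \<bar>sqrt (real (k n)) * (\<Delta> n \<omega> / tail_scale F (real n / real (k n)) - 1)\<bar> > Ca} \<le> \<epsilon> / 4"
    by (rule bounded_in_probD[OF \<Delta>, of "\<epsilon> / 4"]) (use \<epsilon> in auto)
  \<comment> \<open>Makes the failure probability 8 / (k u^2) of
    \<open>order_stat_near_quantile\<close> equal to \<epsilon> / 4 for u = Cb / sqrt k.\<close>
  define Cb where "Cb = sqrt (32 / \<epsilon>)"
  have Cb: "0 < Cb" "Cb\<^sup>2 = 32 / \<epsilon>" using \<epsilon> by (auto simp: Cb_def)
  define u where "u n = Cb * r n" for n
  have u0: "u \<longlonglongrightarrow> 0" unfolding u_def[abs_def] using r0 by (auto intro: tendsto_mult_right_zero)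
  obtain CA where CA: "\<forall>\<^sub>F t in at_top.
    (\<forall>T\<ge>0. \<bar>(?V (t * exp T) - ?V t) / tail_scale F t - gp_quantile \<gamma> T\<bar>
        \<le> CA * \<bar>A t\<bar> * gp_quantile \<gamma> T)
    \<and> (\<forall>u. \<bar>u\<bar> \<le> 1 / 2 \<longrightarrow> \<bar>?V (t * exp u) - ?V t\<bar> \<le> 3 * exp \<bar>\<gamma>\<bar> * \<bar>u\<bar> * tail_scale F t)"
    using tail_quantile_expansion[OF ev so] by blast
  \<comment> \<open>\<open>C1\<close>, \<open>C2\<close> and \<open>Ca\<close> measure the errors of
    expansion, location and scale in units of r; \<open>C\<close> adds the error of the
    index.\<close>
  define C1 where "C1 = \<bar>CA\<bar> * (\<bar>\<Lambda>\<bar> + 1)"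
  define C2 where "C2 = 3 * exp \<bar>\<gamma>\<bar> * Cb"
  define C where "C = 2 * (C1 + C2 + Ca) + C\<gamma>"
  have Cs: "0 \<le> C1" "0 \<le> C2" "0 \<le> C" using Cb Ca C\<gamma> by (auto simp: C1_def C2_def C_def)
  obtain \<kappa> where \<kappa>: "0 < \<kappa>" "\<And>r T g y. 0 \<le> T \<Longrightarrow> 0 \<le> r \<Longrightarrow> r \<le> \<kappa> \<Longrightarrow> r * w_log \<gamma> T \<le> \<kappa> \<Longrightarrow>
    \<bar>g - \<gamma>\<bar> \<le> C * r \<Longrightarrow> \<bar>y - gp_quantile \<gamma> T\<bar> \<le> C * r * (1 + gp_quantile \<gamma> T) \<Longrightarrow>
    \<bar>exp T * gp_tail g y - 1\<bar> \<le> \<eta> / 2"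
    using gp_tail_uniform[of "\<eta> / 2" C \<gamma>] \<eta> Cs by (metis half_gt_zero)

  have A_bound: "\<forall>\<^sub>F n in sequentially. CA * \<bar>A (t n)\<bar> \<le> C1 * r n"
  proof -
    have "\<forall>\<^sub>F n in sequentially. \<bar>sqrt (real (k n)) * A (t n)\<bar> < \<bar>\<Lambda>\<bar> + 1"
      using tendsto_rabs[OF A] unfolding t_def by (rule order_tendstoD(2)) simp
    then show ?thesis using kpos
    proof eventually_elim
      case (elim n)
      then have "\<bar>A (t n)\<bar> \<le> (\<bar>\<Lambda>\<bar> + 1) * r n"
        by (simp add: abs_mult r_def pos_le_divide_eq mult.commute)
      then have "\<bar>CA\<bar> * \<bar>A (t n)\<bar> \<le> \<bar>CA\<bar> * ((\<bar>\<Lambda>\<bar> + 1) * r n)" by (intro mult_left_mono) auto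
      moreover have "CA * \<bar>A (t n)\<bar> \<le> \<bar>CA\<bar> * \<bar>A (t n)\<bar>" by (intro mult_right_mono) auto
      ultimately show ?case by (simp add: C1_def mult.assoc)
    qed
  qed
  have exp_n: "\<forall>\<^sub>F n in sequentially.
    (\<forall>T\<ge>0. \<bar>(?V (t n * exp T) - ?V (t n)) / a n - gp_quantile \<gamma> T\<bar> \<le> CA * \<bar>A (t n)\<bar> * gp_quantile \<gamma> T)
    \<and> (\<forall>u. \<bar>u\<bar> \<le> 1 / 2 \<longrightarrow> \<bar>?V (t n * exp u) - ?V (t n)\<bar> \<le> 3 * exp \<bar>\<gamma>\<bar> * \<bar>u\<bar> * a n)"
    unfolding a_def using CA t_top by (rule eventually_compose_filterlim)
  have w_small: "\<forall>\<^sub>F n in sequentially. r n * w \<gamma> (real (k n) / (real n * \<delta> n)) \<le> \<kappa>"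
    using order_tendstoD(2)[OF w \<kappa>(1)] by eventually_elim (simp add: r_def)
  have r_small: "\<forall>\<^sub>F n in sequentially. r n < min \<kappa> (min 1 (1 / (2 * Ca)))"
    using r0 by (rule order_tendstoD(2)) (use \<kappa> Ca in auto)
  have u_small: "\<forall>\<^sub>F n in sequentially. u n < \<eta> / 2"
    using u0 by (rule order_tendstoD(2)) (use \<eta> in auto)
  have n\<delta>1: "\<forall>\<^sub>F n in sequentially. real n * \<delta> n < 1"
    using n\<delta> by (rule order_tendstoD(2)) simp
  \<comment> \<open>With exp u <= 2 this gives t exp (-u) > 1, and 1 - F x < 1 / 2 beyond the
    threshold.\<close>
  have t4: "\<forall>\<^sub>F n in sequentially. 4 < t n"
    using t_top by (simp add: filterlim_at_top_dense)
  define \<epsilon>' where "\<epsilon>' = \<eta> / 3"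
  have \<epsilon>': "0 < \<epsilon>'" "\<epsilon>' \<le> 1" using \<eta> by (auto simp: \<epsilon>'_def)
  have k_large: "\<forall>\<^sub>F n in sequentially. 4 / (\<epsilon>' ^ 3 * (real (k n) / 2)) \<le> \<epsilon> / 4"
  proof -
    have "\<forall>\<^sub>F n in sequentially. real (k n) \<ge> 32 / (\<epsilon>' ^ 3 * \<epsilon>)"
      using k_real by (simp add: filterlim_at_top)
    then show ?thesis using kpos
      by eventually_elim (use \<epsilon> \<epsilon>' in \<open>simp add: field_simps\<close>)
  qed
  show ?thesis
    using kpos C\<gamma>(2) Ca(2) A_bound exp_n w_small r_small u_small n\<delta>1 t4 k_large
  proof eventually_elim
    case (elim n)
    have kn: "0 < k n" "k n < n" "0 < n" and r: "0 < r n" "r n \<le> \<kappa>" "r n \<le> 1" "Ca * r n \<le> 1 / 2"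
      using elim(1,7) Ca by (auto simp: r_def field_simps)
    have un: "0 < u n" "u n \<le> 1 / 2" "u n \<le> \<eta> / 2" using elim(8) \<eta> r Cb by (auto simp: u_def)
    have tn: "4 < t n" using elim by simp
    have an: "0 < a n" using deriv_tail_quantile_pos(2)[OF ev, of "t n"] tn by (simp add: a_def)
    have eu: "exp (u n) \<le> 2" using exp_bound_half[of "u n"] un by simp
    have emu: "1 / 2 \<le> exp (- u n)" using eu by (simp add: exp_minus field_simps)
    have tu: "1 < t n * exp (- u n)" "1 < t n * exp (u n)"
      using mult_mono[of 4 "t n" "1 / 2" "exp (- u n)"] mult_mono[of 4 "t n" 1 "exp (u n)"] tn emu un
      by auto
    define B1 where "B1 = {\<omega>\<in>space M. \<bar>sqrt (real (k n)) * (\<Gamma> n \<omega> - \<gamma>)\<bar> > C\<gamma>}"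
    define B2 where "B2 = {\<omega>\<in>space M. \<bar>sqrt (real (k n)) * (\<Delta> n \<omega> / a n - 1)\<bar> > Ca}"
    obtain B3 where B3: "B3 \<in> events" "prob B3 \<le> 8 / (real (k n) * (u n)\<^sup>2)"
      "\<And>\<omega>. \<omega> \<in> space M - B3 \<Longrightarrow> ?V (t n * exp (- u n)) \<le> order_stat n (\<lambda>i. X i \<omega>) (n - k n) \<and>
         order_stat n (\<lambda>i. X i \<omega>) (n - k n) \<le> ?V (t n * exp (u n))"
      using order_stat_near_quantile[OF kn(1,2) un(1,2)] tu(1) unfolding t_def by metis
    have "real (k n) * (u n)\<^sup>2 = Cb\<^sup>2" using kn by (simp add: u_def r_def power_mult_distrib power_divide)
    then have pB3: "prob B3 \<le> \<epsilon> / 4" using B3(2) Cb \<epsilon> by simp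
    \<comment> \<open>Left of the threshold 1 - F x is at least exp (-u) / t >= k / (2 n). At this
      level the failure probability is of order 1 / k.\<close>
    obtain B4 where B4: "B4 \<in> events" "prob B4 \<le> 4 / (\<epsilon>' ^ 3 * (real n * (real (k n) / (2 * real n))))"
      "\<And>\<omega> x. \<omega> \<in> space M - B4 \<Longrightarrow> real (k n) / (2 * real n) \<le> 1 - F x \<Longrightarrow>
        \<bar>real (card {i\<in>{..<n}. x \<le> X i \<omega>}) / real n / (1 - F x) - 1\<bar> \<le> 3 * \<epsilon>'"
      using empirical_survival_ratio[OF kn(3) _ \<epsilon>', of "real (k n) / (2 * real n)"] kn by auto
    have "real n * (real (k n) / (2 * real n)) = real (k n) / 2" using kn by simp
    then have pB4: "prob B4 \<le> \<epsilon> / 4" using order_trans[OF B4(2)] elim(11) by presburger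
    have B12: "B1 \<in> events" "B2 \<in> events" unfolding B1_def B2_def by measurable
    have pB12: "prob B1 \<le> \<epsilon> / 4" "prob B2 \<le> \<epsilon> / 4"
      using elim(2,3) by (simp_all add: B1_def B2_def a_def t_def)
    have "prob ((B1 \<union> B2) \<union> (B3 \<union> B4)) \<le> \<epsilon>"
      using measure_Un_le[of "B1 \<union> B2" M "B3 \<union> B4"] measure_Un_le[OF B12] measure_Un_le[OF B3(1) B4(1)]
        B12 B3(1) B4(1) pB12 pB3 pB4 by auto
    moreover have "(\<forall>x. order_stat n (\<lambda>i. X i \<omega>) (n - k n) \<le> x \<longrightarrow> \<delta> n \<le> 1 - F x \<longrightarrow> 1 / 2 < F x \<and>
        \<bar>right_tail_est n (k n) (\<Gamma> n \<omega>) (\<Delta> n \<omega>) (\<lambda>i. X i \<omega>) x / (1 - F x) - 1\<bar> \<le> \<eta>) \<and>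
      (\<forall>x. x < order_stat n (\<lambda>i. X i \<omega>) (n - k n) \<longrightarrow> 0 < 1 - F x \<and>
        \<bar>real (card {i\<in>{..<n}. x \<le> X i \<omega>}) / real n / (1 - F x) - 1\<bar> \<le> \<eta>)"
      if \<omega>: "\<omega> \<in> space M - ((B1 \<union> B2) \<union> (B3 \<union> B4))" for \<omega>
    proof (intro conjI allI impI)
      define b where "b = order_stat n (\<lambda>i. X i \<omega>) (n - k n)"
      have b: "?V (t n * exp (- u n)) \<le> b" "b \<le> ?V (t n * exp (u n))"
        using B3(3)[of \<omega>] \<omega> by (auto simp: b_def)
      {
        fix x assume "x < order_stat n (\<lambda>i. X i \<omega>) (n - k n)"
        then have "F x \<le> F (?V (t n * exp (u n)))" using b by (intro mono) (simp add: b_def)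
        also have "\<dots> = 1 - exp (- u n) / t n" using tu(2) by (simp add: F_tail_quantile exp_minus field_simps)
        also have "\<dots> \<le> 1 - 1 / 2 / t n"
          using emu tn by (intro diff_left_mono divide_right_mono) auto
        finally have c: "real (k n) / (2 * real n) \<le> 1 - F x" by (simp add: t_def)
        moreover have "0 < real (k n) / (2 * real n)" using kn by simp
        ultimately show "0 < 1 - F x" by linarith
        show "\<bar>real (card {i\<in>{..<n}. x \<le> X i \<omega>}) / real n / (1 - F x) - 1\<bar> \<le> \<eta>"
          using B4(3)[OF _ c, of \<omega>] \<omega> by (simp add: \<epsilon>'_def)
      }
      fix x assume x: "order_stat n (\<lambda>i. X i \<omega>) (n - k n) \<le> x" and \<delta>x: "\<delta> n \<le> 1 - F x"
      define p where "p = 1 - F x"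
      have "F (?V (t n * exp (- u n))) \<le> F x" using b x by (intro mono) (simp add: b_def)
      moreover have "F (?V (t n * exp (- u n))) = 1 - exp (u n) / t n"
        using tu(1) by (simp add: F_tail_quantile exp_minus field_simps)
      ultimately have p: "p \<le> exp (u n) / t n" by (simp add: p_def)
      also have "exp (u n) / t n \<le> 2 / t n" using eu tn by (intro divide_right_mono) auto
      also have "2 / t n < 1 / 2" using tn by (simp add: field_simps)
      finally have p2: "p < 1 / 2" .
      then show "1 / 2 < F x" by (simp add: p_def)
      have p0: "0 < p" "\<delta> n \<le> p" using \<delta>x \<delta>[of n] by (auto simp: p_def)
      define T where "T = - ln (p * t n)"
      have T: "t n * exp T = 1 / p" using p0 tn by (simp add: T_def exp_minus field_simps)
      have Tu: "- u n \<le> T"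
      proof -
        have "p * t n \<le> exp (u n)" using p tn by (simp add: pos_le_divide_eq)
        then have "ln (p * t n) \<le> u n" using p0 tn by (metis exp_gt_zero ln_exp ln_mono mult_pos_pos order.strict_trans zero_less_numeral)
        then show ?thesis by (simp add: T_def)
      qed
      have Vx: "?V (t n * exp T) = x"
      proof (rule tail_quantile_F)
        show "1 < t n * exp T" "F x = 1 - 1 / (t n * exp T)"
          unfolding T using p0 p2 by (auto simp: p_def)
        then show "isCont ?V (t n * exp T)"
          using deriv_tail_quantile_pos(3)[OF ev] by (blast intro: DERIV_isCont)
      qed
      define y where "y T = (?V (t n * exp T) - b) / \<Delta> n \<omega>" for T
      have "\<bar>?V (t n) - b\<bar> \<le> C2 * r n * a n"
      proof -
        have "\<bar>?V (t n * exp s) - ?V (t n)\<bar> \<le> C2 * r n * a n" if "\<bar>s\<bar> = u n" for s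
        proof -
          have "\<bar>?V (t n * exp s) - ?V (t n)\<bar> \<le> 3 * exp \<bar>\<gamma>\<bar> * \<bar>s\<bar> * a n"
            by (rule elim(5)[THEN conjunct2, rule_format]) (use that un(2) in simp)
          also have "3 * exp \<bar>\<gamma>\<bar> * \<bar>s\<bar> = C2 * r n" unfolding that by (simp add: C2_def u_def)
          finally show ?thesis .
        qed
        from this[of "u n"] this[of "- u n"] show ?thesis using b un by auto
      qed
      then have s: "\<bar>(b - ?V (t n)) / a n\<bar> \<le> C2 * r n"
        using an by (simp add: abs_divide pos_divide_le_eq abs_minus_commute)
      have sq: "sqrt (real (k n)) > 0" using kn by simp
      have "\<bar>\<Delta> n \<omega> / a n - 1\<bar> * sqrt (real (k n)) \<le> Ca" "\<bar>\<Gamma> n \<omega> - \<gamma>\<bar> * sqrt (real (k n)) \<le> C\<gamma>"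
        using \<omega> by (auto simp: B1_def B2_def abs_mult not_less mult.commute)
      then have q: "\<bar>\<Delta> n \<omega> / a n - 1\<bar> \<le> Ca * r n" and g: "\<bar>\<Gamma> n \<omega> - \<gamma>\<bar> \<le> C\<gamma> * r n"
        using sq by (simp_all add: r_def pos_le_divide_eq)
      have "C\<gamma> * r n \<le> C * r n" using Cs Ca r by (intro mult_right_mono) (auto simp: C_def)
      with g have g: "\<bar>\<Gamma> n \<omega> - \<gamma>\<bar> \<le> C * r n" by linarith
      have \<Delta>_pos: "0 < \<Delta> n \<omega>"
      proof -
        have "0 < \<Delta> n \<omega> / a n" using q r(4) by linarith
        then show ?thesis using an by (simp add: zero_less_divide_iff)
      qed
      \<comment> \<open>Stated for a free S, since it is applied both at S = T and at S = 0.\<close>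
      have main: "\<bar>exp S * gp_tail (\<Gamma> n \<omega>) (y S) - 1\<bar> \<le> \<eta> / 2"
        if S: "0 \<le> S" "r n * w_log \<gamma> S \<le> \<kappa>" for S
      proof (rule \<kappa>(2)[OF S(1) _ r(2) S(2) g])
        let ?G = "gp_quantile \<gamma> S"
        have G: "0 \<le> ?G" using S(1) by (rule gp_quantile_nonneg)
        have "\<bar>(?V (t n * exp S) - ?V (t n)) / a n - ?G\<bar> \<le> CA * \<bar>A (t n)\<bar> * ?G"
          using elim(5) S by blast
        also have "\<dots> \<le> C1 * r n * ?G" using elim(4) G by (intro mult_right_mono)
        finally have v: "\<bar>(?V (t n * exp S) - ?V (t n)) / a n - ?G\<bar> \<le> C1 * r n * ?G" .
        have "y S = ((?V (t n * exp S) - ?V (t n)) / a n - (b - ?V (t n)) / a n) / (\<Delta> n \<omega> / a n)"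
          using an by (simp add: y_def diff_divide_distrib[symmetric])
        then have "\<bar>y S - ?G\<bar> \<le> 2 * (C1 + C2 + Ca) * r n * (1 + ?G)"
          using excess_error[OF G _ r(3) Cs(1,2) _ v s q r(4)] r Ca by simp
        also have "\<dots> \<le> C * r n * (1 + ?G)"
          using C\<gamma> r G by (intro mult_right_mono) (auto simp: C_def)
        finally show "\<bar>y S - ?G\<bar> \<le> C * r n * (1 + ?G)" .
      qed (use r in auto)
      have "right_tail_est n (k n) (\<Gamma> n \<omega>) (\<Delta> n \<omega>) (\<lambda>i. X i \<omega>) x / (1 - F x)
          = exp T * gp_tail (\<Gamma> n \<omega>) (y T)"
      proof -
        have "exp T = real (k n) / real n / p" using p0 kn T by (simp add: t_def field_simps)
        moreover have "y T = (x - b) / \<Delta> n \<omega>" by (simp only: y_def Vx)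
        ultimately show ?thesis by (simp add: right_tail_est_def b_def p_def)
      qed
      moreover have "\<bar>exp T * gp_tail (\<Gamma> n \<omega>) (y T) - 1\<bar> \<le> \<eta>"
      proof (cases "0 \<le> T")
        case True
        \<comment> \<open>As n \<delta> < 1 <= k, D >= 1 and \<open>w_eq_w_log\<close> applies. The
          bound 1 - F x >= \<delta> becomes T <= ln D, so monotonicity of the weight reduces all x
          to the rate condition at D.\<close>
        define D where "D = real (k n) / (real n * \<delta> n)"
        have "1 \<le> D" using elim(9) kn \<delta>[of n] unfolding D_def by (subst pos_le_divide_eq) auto
        moreover have "T \<le> ln D"
        proof -
          have "exp T = 1 / (p * t n)" using p0 tn by (simp add: T_def exp_minus field_simps)
          also have "\<dots> \<le> 1 / (\<delta> n * t n)"
            using p0 tn \<delta>[of n] by (intro divide_left_mono mult_right_mono) auto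
          also have "\<dots> = D" using kn by (simp add: D_def t_def)
          finally have "exp T \<le> D" .
          then show ?thesis using ln_mono[of "exp T" D] by simp
        qed
        ultimately have "w_log \<gamma> T \<le> w \<gamma> D"
          using True by (simp add: w_eq_w_log w_log_mono)
        then have "r n * w_log \<gamma> T \<le> r n * w \<gamma> D" using r by (intro mult_left_mono) auto
        then have "r n * w_log \<gamma> T \<le> \<kappa>" using elim(6) by (simp add: D_def)
        from main[OF True this] show ?thesis using \<eta> by linarith
      next
        \<comment> \<open>Here x lies between the threshold and V (t n), out of reach of
          \<open>main\<close>. Comparison with S = 0 costs a further u n <= \<eta> / 2.\<close>
        case False
        have "x \<le> ?V (t n)"
        proof -
          have "1 < 1 / p" "1 / p \<le> t n"
            using p0 p2 False tn mult_left_mono[of "exp T" 1 "t n"] unfolding T[symmetric] by (auto simp: T)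
          then have "1 / t n \<le> p" using p0 tn by (simp add: field_simps)
          then have "1 - 1 / (1 / p) \<le> F (?V (t n))" using F_tail_quantile[of "t n"] tn
            by simp
          then show ?thesis using tail_quantile_le_iff[OF \<open>1 < 1 / p\<close>, of "?V (t n)"] Vx by (simp add: T)
        qed
        then have "\<bar>exp T * gp_tail (\<Gamma> n \<omega>) (y T) - 1\<bar> \<le> \<eta> / 2 + u n"
          using main[of 0] r \<kappa>(1) False x \<Delta>_pos un \<eta> Tu
          by (intro exp_gp_tail_below[where ?y0.0 = "y 0"])
             (auto simp: y_def Vx b_def intro!: divide_right_mono)
        then show ?thesis using un by linarith
      qed
      ultimately show "\<bar>right_tail_est n (k n) (\<Gamma> n \<omega>) (\<Delta> n \<omega>) (\<lambda>i. X i \<omega>) x / (1 - F x) - 1\<bar> \<le> \<eta>"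
        by simp
    qed
    ultimately show ?case using B12 B3(1) B4(1) by (intro bexI[of _ "(B1 \<union> B2) \<union> (B3 \<union> B4)"]) auto
  qed
qed

end

section \<open>Both tails\<close>

lemma order_stat_cong:
  assumes "\<And>i. i < n \<Longrightarrow> xs i = ys i"
  shows "order_stat n xs j = order_stat n ys j"
proof -
  have "map xs [0..<n] = map ys [0..<n]" using assms by simp
  then show ?thesis by (simp only: order_stat_def)
qed

lemma order_stat_uminus:
  assumes "k < n"
  shows "order_stat n (\<lambda>i. - xs i) (n - k) = - order_stat n xs (k + 1)"
proof -
  let ?L = "sort (map xs [0..<n])"
  have "sort (map (\<lambda>i. - xs i) [0..<n]) = rev (map uminus ?L)"
  proof (rule properties_for_sort)
    have "mset (rev (map uminus ?L)) = image_mset uminus (mset (map xs [0..<n]))" by simp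
    also have "\<dots> = mset (map (\<lambda>i. - xs i) [0..<n])" by (simp add: image_mset.compositionality comp_def)
    finally show "mset (rev (map uminus ?L)) = mset (map (\<lambda>i. - xs i) [0..<n])" .
    have "sorted_wrt (\<lambda>x y. - y \<le> - x) ?L" using sorted_sort[of "map xs [0..<n]"] by simp
    then show "sorted (rev (map uminus ?L))" by (simp add: sorted_wrt_rev sorted_wrt_map)
  qed
  then show ?thesis using assms by (simp add: order_stat_def rev_nth)
qed

lemma left_tail_est_eq_right_tail_est:
  assumes "k < n"
  shows "left_tail_est n k g c xs x = right_tail_est n k g c (\<lambda>i. - xs i) (- x)"
  using order_stat_uminus[OF assms, of xs] by (simp add: left_tail_est_def right_tail_est_def)

text \<open>Just left of x the empirical distribution function is constant and counts the
  observations strictly below x.\<close>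

lemma emp_surv_eq:
  assumes "0 < n"
  shows "emp_surv n xs x = real (card {i\<in>{..<n}. x \<le> xs i}) / real n"
proof -
  let ?c = "real (card {i\<in>{..<n}. xs i < x})"
  have "\<forall>\<^sub>F y in at_left x. \<forall>i\<in>{..<n}. xs i \<le> y \<longleftrightarrow> xs i < x"
  proof (intro eventually_ball_finite ballI)
    fix i
    show "\<forall>\<^sub>F y in at_left x. xs i \<le> y \<longleftrightarrow> xs i < x"
    proof (cases "xs i < x")
      case True
      have "\<forall>\<^sub>F y in at_left x. y \<in> {xs i<..<x}" using True by (rule eventually_at_left_real)
      then show ?thesis by eventually_elim auto
    next
      case False
      have "\<forall>\<^sub>F y in at_left x. y \<in> {x - 1<..<x}" by (rule eventually_at_left_real) simp
      then show ?thesis by eventually_elim (use False in auto)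
    qed
  qed simp
  then have "\<forall>\<^sub>F y in at_left x. emp_cdf n xs y = ?c / real n"
  proof eventually_elim
    case (elim y)
    then have "{i\<in>{..<n}. xs i \<le> y} = {i\<in>{..<n}. xs i < x}" by auto
    then show ?case by (simp only: emp_cdf_def)
  qed
  then have "Lim (at_left x) (emp_cdf n xs) = ?c / real n"
    by (intro tendsto_Lim tendsto_eventually) auto
  moreover have "?c + real (card {i\<in>{..<n}. x \<le> xs i}) = real n"
  proof -
    have "card ({i\<in>{..<n}. xs i < x} \<union> {i\<in>{..<n}. x \<le> xs i}) = card {..<n}"
      by (intro arg_cong[where f = card]) auto
    then show ?thesis by (subst (asm) card_Un_disjoint) auto
  qed
  ultimately show ?thesis using assms by (simp add: emp_surv_def field_simps)
qed

text \<open>Multiplication by 1 - \<eta> and by 1 + \<eta> commutes with the minimum, the former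
  because \<eta> <= 1.\<close>

lemma min_ratio_close:
  fixes a b p q :: real
  assumes "0 < p" "0 < q" "\<bar>a / p - 1\<bar> \<le> \<eta>" "\<bar>b / q - 1\<bar> \<le> \<eta>" "\<eta> \<le> 1"
  shows "\<bar>min a b / min p q - 1\<bar> \<le> \<eta>"
proof -
  have 1: "(1 - \<eta>) * p \<le> a" "a \<le> (1 + \<eta>) * p" "(1 - \<eta>) * q \<le> b" "b \<le> (1 + \<eta>) * q"
    using assms by (simp_all add: abs_le_iff field_simps)
  have 0: "0 \<le> \<eta>" using assms(3) by linarith
  have "(1 - \<eta>) * min p q \<le> (1 - \<eta>) * p" "(1 - \<eta>) * min p q \<le> (1 - \<eta>) * q"
    using assms(5) by (intro mult_left_mono; simp)+
  then have "(1 - \<eta>) * min p q \<le> min a b" using 1 by linarith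
  moreover have "min a b \<le> (1 + \<eta>) * min p q" using 1 0 by (auto simp: min_def)
  moreover have "0 < min p q" using assms by simp
  ultimately have "1 - \<eta> \<le> min a b / min p q" "min a b / min p q \<le> 1 + \<eta>"
    by (simp_all only: pos_le_divide_eq pos_divide_le_eq)
  then show ?thesis by (simp add: abs_le_iff)
qed

text \<open>F appears without a left limit because a continuous law has no atoms.\<close>

lemma (in iid_sample) cdf_uminus: "cdf (distr M borel (\<lambda>\<omega>. - X i \<omega>)) x = 1 - F (- x)"
proof -
  have "cdf (distr M borel (\<lambda>\<omega>. - X i \<omega>)) x = prob {\<omega>\<in>space M. - x \<le> X i \<omega>}"
    unfolding cdf_def by (subst measure_distr) (auto intro!: arg_cong[where f = prob])
  then show ?thesis by (simp add: prob_ge)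
qed

lemma (in iid_sample) iid_sample_uminus:
  "iid_sample M (\<lambda>i \<omega>. - X i \<omega>) (\<lambda>x. 1 - F (- x))"
proof
  show "indep_vars (\<lambda>_. borel) (\<lambda>i \<omega>. - X i \<omega>) UNIV"
    by (rule indep_vars_compose2[OF indep]) auto
  show "cdf (distr M borel (\<lambda>\<omega>. - X i \<omega>)) = (\<lambda>x. 1 - F (- x))" for i
    by (rule ext) (rule cdf_uminus)
  show "continuous_on UNIV (\<lambda>x. 1 - F (- x))"
    by (intro continuous_intros continuous_on_compose2[OF continuous]) auto
qed

theorem theorem1:
  fixes M :: "'a measure"
    and X :: "nat \<Rightarrow> 'a \<Rightarrow> real"
    and F F_neg :: "real \<Rightarrow> real"
    and k :: "nat \<Rightarrow> nat"
    and \<delta> :: "nat \<Rightarrow> real"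
    and \<gamma> \<rho> \<Lambda> \<gamma>\<^sub>l \<rho>\<^sub>l \<Lambda>\<^sub>l :: real
    and A A\<^sub>l :: "real \<Rightarrow> real"
    and gh ah gh\<^sub>l ah\<^sub>l :: "nat \<Rightarrow> (nat \<Rightarrow> real) \<Rightarrow> real"
  assumes "prob_space M"
    and "prob_space.indep_vars M (\<lambda>_. borel) X UNIV"
    and "\<And>i. cdf (distr M borel (X i)) = F"
    and "F_neg = cdf (distr M borel (\<lambda>\<omega>. - X 0 \<omega>))"
    and "continuous_on UNIV F"
    and "0 < F 0" "F 0 < 1"
    \<comment> \<open>for \<open>n \<le> 2\<close> no positive integer is below \<open>n / 2\<close>\<close>
    and "\<And>n. n \<ge> 3 \<Longrightarrow> 0 < k n \<and> real (k n) < real n / 2"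
    and "filterlim k at_top sequentially"
    and "(\<lambda>n. real (k n) / real n) \<longlonglongrightarrow> 0"
    and "\<And>n. 0 < \<delta> n \<and> \<delta> n < 1 / 2"
    and "(\<lambda>n. real n * \<delta> n) \<longlonglongrightarrow> 0"
    \<comment> \<open>the estimators are measurable functions of the sample\<close>
    and "\<And>n. gh n \<in> borel_measurable (Pi\<^sub>M {..<n} (\<lambda>_. borel))"
    and "\<And>n. ah n \<in> borel_measurable (Pi\<^sub>M {..<n} (\<lambda>_. borel))"
    and "\<And>n. gh\<^sub>l n \<in> borel_measurable (Pi\<^sub>M {..<n} (\<lambda>_. borel))"
    and "\<And>n. ah\<^sub>l n \<in> borel_measurable (Pi\<^sub>M {..<n} (\<lambda>_. borel))"
    \<comment> \<open>right tail\<close>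
    and "extreme_value_cond F \<gamma>"
    and "second_order_cond F \<gamma> \<rho> A"
    and "(\<lambda>n. sqrt (real (k n)) * A (real n / real (k n))) \<longlonglongrightarrow> \<Lambda>"
    and "bounded_in_prob M (\<lambda>n \<omega>. sqrt (real (k n)) * (gh n (sample X n \<omega>) - \<gamma>))"
    and "bounded_in_prob M (\<lambda>n \<omega>. sqrt (real (k n)) *
           (ah n (sample X n \<omega>) / tail_scale F (real n / real (k n)) - 1))"
    and "(\<lambda>n. w \<gamma> (real (k n) / (real n * \<delta> n)) / sqrt (real (k n))) \<longlonglongrightarrow> 0"
    \<comment> \<open>left tail\<close>
    and "extreme_value_cond F_neg \<gamma>\<^sub>l"
    and "second_order_cond F_neg \<gamma>\<^sub>l \<rho>\<^sub>l A\<^sub>l"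
    and "(\<lambda>n. sqrt (real (k n)) * A\<^sub>l (real n / real (k n))) \<longlonglongrightarrow> \<Lambda>\<^sub>l"
    and "bounded_in_prob M (\<lambda>n \<omega>. sqrt (real (k n)) * (gh\<^sub>l n (sample X n \<omega>) - \<gamma>\<^sub>l))"
    and "bounded_in_prob M (\<lambda>n \<omega>. sqrt (real (k n)) *
           (ah\<^sub>l n (sample X n \<omega>) / tail_scale F_neg (real n / real (k n)) - 1))"
    and "(\<lambda>n. w \<gamma>\<^sub>l (real (k n) / (real n * \<delta> n)) / sqrt (real (k n))) \<longlonglongrightarrow> 0"
  shows "tendsto_in_prob M
    (\<lambda>n \<omega>. SUP x\<in>{x. depth F x \<ge> \<delta> n}.
       ereal \<bar>refined_depth n (k n) (gh n (sample X n \<omega>)) (ah n (sample X n \<omega>))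
                (gh\<^sub>l n (sample X n \<omega>)) (ah\<^sub>l n (sample X n \<omega>)) (sample X n \<omega>) x
              / depth F x - 1\<bar>) 0"
proof -
  interpret prob_space M by fact
  interpret R: iid_sample M X F
    by unfold_locales fact+
  have F_neg: "F_neg = (\<lambda>x. 1 - F (- x))"
    using assms(4) R.cdf_uminus[of 0] by auto
  interpret L: iid_sample M "\<lambda>i \<omega>. - X i \<omega>" F_neg
    unfolding F_neg by (rule R.iid_sample_uminus)
  have sample_meas [measurable]: "sample X n \<in> measurable M (Pi\<^sub>M {..<n} (\<lambda>_. borel))" for n
    unfolding sample_def by measurable
  have k: "\<forall>n\<ge>3. 0 < k n \<and> real (k n) < real n / 2" using assms(8) by blast
  note meas = measurable_compose[OF sample_meas]
  show ?thesis
    unfolding tendsto_in_prob_def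
  proof (intro allI impI tendsto_zero_ennreal)
    fix e r :: real assume e: "0 < e" and r: "0 < r"
    define \<eta> where "\<eta> = min e 1"
    have \<eta>: "0 < \<eta>" "\<eta> \<le> 1" "\<eta> \<le> e" using e by (auto simp: \<eta>_def)
    \<comment> \<open>A third for each tail leaves the strict inequality below r.\<close>
    have "0 < r / 3" using r by simp
    note right = R.one_sided[OF k assms(9-12) meas[OF assms(13)] meas[OF assms(14)]
        assms(17-22) this \<eta>(1,2)]
    note left = L.one_sided[OF k assms(9-12) meas[OF assms(15)] meas[OF assms(16)]
        assms(23-28) \<open>0 < r / 3\<close> \<eta>(1,2)]
    show "\<forall>\<^sub>F n in sequentially. outer_measure_of M {\<omega>\<in>space M.
        ereal e < \<bar>(SUP x\<in>{x. \<delta> n \<le> depth F x}.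
          ereal \<bar>refined_depth n (k n) (gh n (sample X n \<omega>)) (ah n (sample X n \<omega>))
                (gh\<^sub>l n (sample X n \<omega>)) (ah\<^sub>l n (sample X n \<omega>)) (sample X n \<omega>) x
              / depth F x - 1\<bar>) - ereal 0\<bar>} < ennreal r"
      using right left eventually_ge_at_top[of 3]
    proof eventually_elim
      case (elim n)
      let ?b = "\<lambda>\<omega>. order_stat n (\<lambda>i. X i \<omega>) (n - k n)"
        and ?b' = "\<lambda>\<omega>. order_stat n (\<lambda>i. X i \<omega>) (k n + 1)"
      have kn: "0 < n" "k n < n" using assms(8)[OF elim(3)] by auto
      obtain B1 where B1: "B1 \<in> events" "prob B1 \<le> r / 3"
        "\<And>\<omega> x. \<omega> \<in> space M - B1 \<Longrightarrow> ?b \<omega> \<le> x \<Longrightarrow> \<delta> n \<le> 1 - F x \<Longrightarrow> 1 / 2 < F x \<and>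
          \<bar>right_tail_est n (k n) (gh n (sample X n \<omega>)) (ah n (sample X n \<omega>)) (\<lambda>i. X i \<omega>) x
            / (1 - F x) - 1\<bar> \<le> \<eta>"
        "\<And>\<omega> x. \<omega> \<in> space M - B1 \<Longrightarrow> x < ?b \<omega> \<Longrightarrow> 0 < 1 - F x \<and>
          \<bar>real (card {i\<in>{..<n}. x \<le> X i \<omega>}) / real n / (1 - F x) - 1\<bar> \<le> \<eta>"
        using elim(1) by blast
      obtain B2 where B2: "B2 \<in> events" "prob B2 \<le> r / 3"
        "\<And>\<omega> x. \<omega> \<in> space M - B2 \<Longrightarrow> order_stat n (\<lambda>i. - X i \<omega>) (n - k n) \<le> x \<Longrightarrow>
          \<delta> n \<le> 1 - F_neg x \<Longrightarrow> 1 / 2 < F_neg x \<and>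
          \<bar>right_tail_est n (k n) (gh\<^sub>l n (sample X n \<omega>)) (ah\<^sub>l n (sample X n \<omega>)) (\<lambda>i. - X i \<omega>) x
            / (1 - F_neg x) - 1\<bar> \<le> \<eta>"
        "\<And>\<omega> x. \<omega> \<in> space M - B2 \<Longrightarrow> x < order_stat n (\<lambda>i. - X i \<omega>) (n - k n) \<Longrightarrow>
          0 < 1 - F_neg x \<and>
          \<bar>real (card {i\<in>{..<n}. x \<le> - X i \<omega>}) / real n / (1 - F_neg x) - 1\<bar> \<le> \<eta>"
        using elim(2) by blast
      have close: "\<bar>refined_depth n (k n) (gh n (sample X n \<omega>)) (ah n (sample X n \<omega>))
            (gh\<^sub>l n (sample X n \<omega>)) (ah\<^sub>l n (sample X n \<omega>)) (sample X n \<omega>) x / depth F x - 1\<bar> \<le> \<eta>"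
        if \<omega>: "\<omega> \<in> space M - (B1 \<union> B2)" and x: "\<delta> n \<le> depth F x" for \<omega> x
      proof -
        have \<omega>': "\<omega> \<in> space M - B1" "\<omega> \<in> space M - B2" using \<omega> by auto
        have Fx: "\<delta> n \<le> F x" "\<delta> n \<le> 1 - F x" using x by (auto simp: depth_def)
        have os: "order_stat n (sample X n \<omega>) j = order_stat n (\<lambda>i. X i \<omega>) j" for j
          by (rule order_stat_cong) (simp add: sample_def)
        have neg: "order_stat n (\<lambda>i. - X i \<omega>) (n - k n) = - ?b' \<omega>"
          by (rule order_stat_uminus[OF kn(2)])
        consider (right) "?b \<omega> \<le> x" | (left) "x < ?b \<omega>" "x \<le> ?b' \<omega>" | (mid) "?b' \<omega> < x" "x < ?b \<omega>"
          by linarith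
        then show ?thesis
        proof cases
          case right
          note * = B1(3)[OF \<omega>'(1) right Fx(2)]
          then have "depth F x = 1 - F x" by (simp add: depth_def)
          with * right show ?thesis by (simp add: refined_depth_def os right_tail_est_def)
        next
          case left
          note * = B2(3)[OF \<omega>'(2), of "- x", unfolded neg]
          have **: "1 / 2 < 1 - F x"
            "\<bar>right_tail_est n (k n) (gh\<^sub>l n (sample X n \<omega>)) (ah\<^sub>l n (sample X n \<omega>)) (\<lambda>i. - X i \<omega>) (- x)
              / F x - 1\<bar> \<le> \<eta>"
            using * left Fx by (simp_all add: F_neg)
          then have "depth F x = F x" by (simp add: depth_def)
          with ** left show ?thesis
            by (simp add: refined_depth_def os left_tail_est_eq_right_tail_est[OF kn(2), symmetric])
               (simp add: left_tail_est_def os)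
        next
          case mid
          have S: "0 < 1 - F x" "\<bar>emp_surv n (sample X n \<omega>) x / (1 - F x) - 1\<bar> \<le> \<eta>"
          proof -
            have "{i\<in>{..<n}. x \<le> sample X n \<omega> i} = {i\<in>{..<n}. x \<le> X i \<omega>}"
              by (auto simp: sample_def)
            then show "0 < 1 - F x" "\<bar>emp_surv n (sample X n \<omega>) x / (1 - F x) - 1\<bar> \<le> \<eta>"
              using B1(4)[OF \<omega>'(1) mid(2)] by (simp_all only: emp_surv_eq[OF kn(1)])
          qed
          \<comment> \<open>Observations at most x are reflected observations at least -x, so the
            empirical distribution function is the survival ratio of the reflected sample.\<close>
          have C: "0 < F x" "\<bar>emp_cdf n (sample X n \<omega>) x / F x - 1\<bar> \<le> \<eta>"
          proof -
            have "{i\<in>{..<n}. sample X n \<omega> i \<le> x} = {i\<in>{..<n}. - x \<le> - X i \<omega>}"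
              by (auto simp: sample_def)
            moreover have "- x < order_stat n (\<lambda>i. - X i \<omega>) (n - k n)" using mid by (simp add: neg)
            ultimately show "0 < F x" "\<bar>emp_cdf n (sample X n \<omega>) x / F x - 1\<bar> \<le> \<eta>"
              using B2(4)[OF \<omega>'(2), of "- x"] by (simp_all add: emp_cdf_def F_neg)
          qed
          show ?thesis
            using min_ratio_close[OF C(1) S(1) C(2) S(2) \<eta>(2)] mid
            by (simp add: refined_depth_def os emp_depth_def depth_def)
        qed
      qed
      \<comment> \<open>An empty supremum would be minus infinity, with infinite absolute value. The
        median has depth 1 / 2 > \<delta> n.\<close>
      have ne: "{x. \<delta> n \<le> depth F x} \<noteq> {}"
      proof -
        have "F (tail_quantile F 2) = 1 / 2" using R.F_tail_quantile[of 2] by simp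
        then have "\<delta> n \<le> depth F (tail_quantile F 2)" using assms(11)[of n] by (simp add: depth_def)
        then show ?thesis by blast
      qed
      let ?bad = "{\<omega>\<in>space M. ereal e < \<bar>(SUP x\<in>{x. \<delta> n \<le> depth F x}.
          ereal \<bar>refined_depth n (k n) (gh n (sample X n \<omega>)) (ah n (sample X n \<omega>))
                (gh\<^sub>l n (sample X n \<omega>)) (ah\<^sub>l n (sample X n \<omega>)) (sample X n \<omega>) x
              / depth F x - 1\<bar>) - ereal 0\<bar>}"
      \<comment> \<open>The bad set is covered by a measurable event, so monotonicity of the outer
        measure transfers the bound.\<close>
      have "?bad \<subseteq> B1 \<union> B2"
      proof (rule ccontr)
        assume "\<not> ?thesis"
        then obtain \<omega> where \<omega>: "\<omega> \<in> ?bad" "\<omega> \<in> space M - (B1 \<union> B2)" by blast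
        let ?f = "\<lambda>x. ereal \<bar>refined_depth n (k n) (gh n (sample X n \<omega>)) (ah n (sample X n \<omega>))
                (gh\<^sub>l n (sample X n \<omega>)) (ah\<^sub>l n (sample X n \<omega>)) (sample X n \<omega>) x / depth F x - 1\<bar>"
        have "(SUP x\<in>{x. \<delta> n \<le> depth F x}. ?f x) \<le> ereal e"
          using close[OF \<omega>(2)] \<eta>(3) by (intro SUP_least) (auto intro: order_trans)
        moreover have "0 \<le> (SUP x\<in>{x. \<delta> n \<le> depth F x}. ?f x)"
          using ne by (auto intro: SUP_upper2)
        ultimately have "\<bar>(SUP x\<in>{x. \<delta> n \<le> depth F x}. ?f x) - ereal 0\<bar> \<le> ereal e"
          by (simp add: zero_ereal_def[symmetric])
        with \<omega>(1) show False by (auto dest: leD)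
      qed
      then have "outer_measure_of M ?bad \<le> outer_measure_of M (B1 \<union> B2)"
        by (rule outer_measure_of_mono)
      also have "\<dots> = ennreal (prob (B1 \<union> B2))"
        using B1(1) B2(1) by (simp add: emeasure_eq_measure)
      also have "\<dots> < ennreal r"
        using measure_Un_le[OF B1(1) B2(1)] B1(2) B2(2) r by (intro ennreal_lessI) auto
      finally show ?case .
    qed
  qed
qed

end
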